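(* Let $t$ be a prime power, $q=t^2$, and let $\mathcal{X}\subset\mathbb{P}^4(\mathbb{F}_q)$ be the non-degenerate hermitian variety $x_0^{t+1}+x_1^{t+1}+x_2^{t+1}+x_3^{t+1}+x_4^{t+1}=0$. The minimum weight codewords of the code $C_2(\mathcal{X})$ are exactly the codewords $c(f)$ for which the quadric $Z(f)$ is a pair of distinct hyperplanes (over $\mathbb{F}_q$), both non-tangent to $\mathcal{X}$, such that the plane of intersection of the two hyperplanes intersects $\mathcal{X}$ in a non-singular hermitian plane curve.
   Context: Functional code: let $\mathcal{F}_2$ be the $\mathbb{F}_q$-vector space of forms of degree 2 in $x_0,\dots,x_4$ (with $0$). The code $C_2(\mathcal{X})$ is the image of the linear map $c:\mathcal{F}_2\to\mathbb{F}_q^{|\mathcal{X}|}$, $c(f)=(c_x(f))_{x\in\mathcal{X}(\mathbb{F}_q)}$, where $c_x(f)=f(x_0,\dots,x_4)/x_i^2$ for $x=(x_0:\dots:x_4)$ and $i$ the smallest index with $x_i\ne0$. The weight of $c(f)$ is $\#\mathcal{X}(\mathbb{F}_q)-\#(\mathcal{X}\cap Z(f))(\mathbb{F}_q)$, where $Z(f)$ is the zero set of $f$ in $\mathbb{P}^4(\mathbb{F}_q)$; minimum weight codewords are the nonzero codewords of smallest weight. A hyperplane is tangent to $\mathcal{X}$ if it is the tangent hyperplane $\sum_i p_i^t x_i=0$ at some point $P=(p_0:\dots:p_4)$ of $\mathcal{X}$. The intersection of $\mathcal{X}$ with a plane is a hermitian plane curve; it is non-singular if its hermitian form (the restriction of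 the hermitian form defining $\mathcal{X}$) has rank 3. *)

theory Defs
  imports "HOL-Analysis.Analysis" "HOL-Library.Poly_Mapping" "HOL-Number_Theory.Prime_Powers"
begin

section \<open>Projective 4-space\<close>

text \<open>
  A projective subspace is represented by the set of points on the underlying vector subspace
  of the coordinate space; a point is a one-dimensional vector subspace. The index type
  \<^typ>\<open>5\<close> has the elements \<open>0 < 1 < 2 < 3 < 4\<close>.
\<close>

definition points :: "('a::field ^ 5) set set" where
  "points = {P. vec.subspace P \<and> vec.dim P = 1}"

definition proj :: "('a::field ^ 5) set \<Rightarrow> ('a ^ 5) set set" where
  "proj W = {P \<in> points. P \<subseteq> W}"

definition hyperplane :: "('a::field ^ 5) set \<Rightarrow> bool" where
  "hyperplane U \<longleftrightarrow> vec.subspace U \<and> vec.dim U = 4"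

section \<open>The hermitian variety\<close>

definition herm_form :: "nat \<Rightarrow> 'a::field ^ 5 \<Rightarrow> 'a ^ 5 \<Rightarrow> 'a" where
  "herm_form t x y = (\<Sum>i\<in>UNIV. x $ i * (y $ i) ^ t)"

definition herm_variety :: "nat \<Rightarrow> ('a::field ^ 5) set set" where
  "herm_variety t = {P \<in> points. \<forall>x\<in>P. (\<Sum>i\<in>UNIV. (x $ i) ^ (t + 1)) = 0}"

definition tangent_at :: "nat \<Rightarrow> 'a::field ^ 5 \<Rightarrow> ('a ^ 5) set" where
  "tangent_at t p = {x. (\<Sum>i\<in>UNIV. (p $ i) ^ t * x $ i) = 0}"

definition tangent_hyperplane :: "nat \<Rightarrow> ('a::field ^ 5) set \<Rightarrow> bool" where
  "tangent_hyperplane t U \<longleftrightarrow> (\<exists>P \<in> herm_variety t. \<exists>p \<in> P - {0}. U = tangent_at t p)"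

text \<open>
  The rank of the restriction of the hermitian form to a vector subspace \<open>W\<close> is the codimension
  in \<open>W\<close> of the radical of that restriction.
\<close>

definition herm_radical :: "nat \<Rightarrow> ('a::field ^ 5) set \<Rightarrow> ('a ^ 5) set" where
  "herm_radical t W = {x \<in> W. \<forall>y\<in>W. herm_form t x y = 0}"

definition herm_rank :: "nat \<Rightarrow> ('a::field ^ 5) set \<Rightarrow> nat" where
  "herm_rank t W = vec.dim W - vec.dim (herm_radical t W)"

definition nonsingular_plane_section :: "nat \<Rightarrow> ('a::field ^ 5) set \<Rightarrow> bool" where
  "nonsingular_plane_section t W \<longleftrightarrow>
     vec.subspace W \<and> vec.dim W = 3 \<and> herm_rank t W = 3"

section \<open>Forms of degree 2\<close>

text \<open>
  A polynomial in \<open>x\<^sub>0, \<dots>, x\<^sub>4\<close> is a finitely supported map from exponent vectors to coefficients.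
\<close>

type_synonym 'a poly5 = "(5 \<Rightarrow>\<^sub>0 nat) \<Rightarrow>\<^sub>0 'a"

definition quadratic_forms :: "'a::field poly5 set" where
  "quadratic_forms = {f. \<forall>m \<in> Poly_Mapping.keys f. (\<Sum>i\<in>UNIV. Poly_Mapping.lookup m i) = 2}"

definition eval_poly :: "'a::field poly5 \<Rightarrow> 'a ^ 5 \<Rightarrow> 'a" where
  "eval_poly f x = (\<Sum>m\<in>Poly_Mapping.keys f.
     Poly_Mapping.lookup f m * (\<Prod>i\<in>UNIV. (x $ i) ^ Poly_Mapping.lookup m i))"

definition zero_set :: "'a::field poly5 \<Rightarrow> ('a ^ 5) set set" where
  "zero_set f = {P \<in> points. \<forall>x\<in>P. eval_poly f x = 0}"

section \<open>The functional code\<close>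

definition normalized_eval :: "'a::field poly5 \<Rightarrow> 'a ^ 5 \<Rightarrow> 'a" where
  "normalized_eval f x = eval_poly f x / (x $ (LEAST i. x $ i \<noteq> 0)) ^ 2"

text \<open>
  The choice of the representative is immaterial for quadratic forms, see
  \<open>point_value_eq\<close> below.
\<close>

definition point_value :: "'a::field poly5 \<Rightarrow> ('a ^ 5) set \<Rightarrow> 'a" where
  "point_value f P = normalized_eval f (SOME x. x \<in> P \<and> x \<noteq> 0)"

text \<open>
  Words are functions on the points of the variety, extended by \<open>undefined\<close> elsewhere.
\<close>

definition codeword :: "nat \<Rightarrow> 'a::field poly5 \<Rightarrow> ('a ^ 5) set \<Rightarrow> 'a" where
  "codeword t f = (\<lambda>P \<in> herm_variety t. point_value f P)"

definition code2 :: "nat \<Rightarrow> (('a::field ^ 5) set \<Rightarrow> 'a) set" where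
  "code2 t = codeword t ` quadratic_forms"

definition weight :: "nat \<Rightarrow> (('a::field ^ 5) set \<Rightarrow> 'a) \<Rightarrow> nat" where
  "weight t w = card {P \<in> herm_variety t. w P \<noteq> 0}"

definition min_weight_codewords :: "nat \<Rightarrow> (('a::field ^ 5) set \<Rightarrow> 'a) set" where
  "min_weight_codewords t =
     {w \<in> code2 t :: (('a ^ 5) set \<Rightarrow> 'a) set. w \<noteq> (\<lambda>P \<in> herm_variety t. 0) \<and>
        (\<forall>w' \<in> code2 t :: (('a ^ 5) set \<Rightarrow> 'a) set.
           w' \<noteq> (\<lambda>P \<in> herm_variety t. 0) \<longrightarrow> weight t w \<le> weight t w')}"

section \<open>Well-definedness\<close>

lemma eval_poly_scale:
  fixes f :: "'a::field poly5"
  assumes "f \<in> quadratic_forms"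
  shows "eval_poly f (c *s x) = c ^ 2 * eval_poly f x"
proof -
  have "(\<Prod>i\<in>UNIV. ((c *s x) $ i) ^ Poly_Mapping.lookup m i)
      = c ^ 2 * (\<Prod>i\<in>UNIV. (x $ i) ^ Poly_Mapping.lookup m i)"
    if "m \<in> Poly_Mapping.keys f" for m
  proof -
    have "(\<Prod>i\<in>UNIV. c ^ Poly_Mapping.lookup m i) = c ^ 2"
      using assms that by (simp add: quadratic_forms_def flip: power_sum)
    then show ?thesis
      by (simp add: power_mult_distrib prod.distrib)
  qed
  then show ?thesis
    unfolding eval_poly_def sum_distrib_left
    by (intro sum.cong) (simp_all add: mult.left_commute)
qed

lemma points_nonzero:
  assumes "P \<in> points"
  obtains x where "x \<in> P" "x \<noteq> 0"
proof -
  have "P \<noteq> {0}" "P \<noteq> {}"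
    using assms by (auto simp: points_def)
  then show ?thesis using that by blast
qed

lemma points_eq_multiples:
  assumes P: "P \<in> points" and x: "x \<in> P" "x \<noteq> 0"
  shows "P = range (\<lambda>c. c *s x)"
proof -
  have sub: "vec.subspace P" and dim: "vec.dim P = 1"
    using P by (auto simp: points_def)
  have "vec.independent {x}" using x by simp
  then have "P \<subseteq> vec.span {x}"
    using vec.card_eq_dim[of "{x}" P] x dim by simp
  moreover have "vec.span {x} \<subseteq> P"
    using x sub by (simp add: vec.span_minimal)
  ultimately show ?thesis by (auto simp: vec.span_singleton)
qed

lemma normalized_eval_scale:
  fixes f :: "'a::field poly5"
  assumes "f \<in> quadratic_forms" "c \<noteq> 0"
  shows "normalized_eval f (c *s x) = normalized_eval f x"
  using assms by (simp add: normalized_eval_def eval_poly_scale power_mult_distrib)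

lemma point_value_eq:
  fixes f :: "'a::field poly5"
  assumes f: "f \<in> quadratic_forms" and P: "P \<in> points" and x: "x \<in> P" "x \<noteq> 0"
  shows "point_value f P = normalized_eval f x"
proof -
  define y where "y = (SOME y. y \<in> P \<and> y \<noteq> 0)"
  have "y \<in> P \<and> y \<noteq> 0"
    unfolding y_def by (rule someI[of _ x]) (use x in simp)
  then obtain c where "y = c *s x" "c \<noteq> 0"
    using points_eq_multiples[OF P x] by auto
  then show ?thesis
    using normalized_eval_scale[OF f] by (simp add: point_value_def flip: y_def)
qed

lemma point_value_eq_0_iff:
  fixes f :: "'a::field poly5"
  assumes f: "f \<in> quadratic_forms" and P: "P \<in> points"
  shows "point_value f P = 0 \<longleftrightarrow> P \<in> zero_set f"
proof -
  obtain x where x: "x \<in> P" "x \<noteq> 0" using points_nonzero[OF P] .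
  obtain i where "x $ i \<noteq> 0" using x by (auto simp: vec_eq_iff)
  then have "x $ (LEAST i. x $ i \<noteq> 0) \<noteq> 0" by (rule LeastI)
  then have "point_value f P = 0 \<longleftrightarrow> eval_poly f x = 0"
    using point_value_eq[OF f P x] by (simp add: normalized_eval_def)
  also have "\<dots> \<longleftrightarrow> (\<forall>y\<in>P. eval_poly f y = 0)"
    using x points_eq_multiples[OF P x] by (auto simp: eval_poly_scale[OF f])
  finally show ?thesis using P by (simp add: zero_set_def)
qed

lemma weight_codeword:
  fixes f :: "'a::{field,finite} poly5"
  assumes f: "f \<in> quadratic_forms"
  shows "weight t (codeword t f)
       = card (herm_variety t :: ('a ^ 5) set set) - card (herm_variety t \<inter> zero_set f)"
proof -
  have "{P \<in> herm_variety t. codeword t f P \<noteq> 0} = herm_variety t - (herm_variety t \<inter> zero_set f)"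
    using point_value_eq_0_iff[OF f] by (auto simp: codeword_def herm_variety_def)
  then show ?thesis
    by (simp add: weight_def card_Diff_subset)
qed

end

theory Submission
  imports Defs
begin

text \<open>
  Everything is counted affinely over \<open>F = F\<^sub>q\<close>, where the vectors of the five-dimensional space form
  a set of size \<open>t\<^sup>1\<^sup>0\<close>. Let \<open>H\<close> be the hermitian form on the diagonal. For a quadratic form \<open>f\<close>
  and \<open>a \<in> F\<close> the function \<open>H + Tr (a f)\<close> is a quadratic form over \<open>F\<^sub>t\<close>. Averaging over \<open>a\<close> expresses the
  number of common zeros of \<open>H\<close> and \<open>f\<close> by the number of zeros of \<open>f\<close> and those of the twisted forms.

  The second moment of the fibre sizes of an \<open>F\<^sub>t\<close>-quadratic form bounds its number of zeros by the size
  of its radical. The radical of \<open>H + Tr (a f)\<close> is the solution set of a semilinear equation; solutions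
  belonging to different norms of \<open>a\<close> lie in different eigenspaces of one linear map, so that the
  radicals cannot be large for many \<open>a\<close>. Hence a quadric which is not a union of hyperplanes meets the
  variety in fewer points than the claimed maximum.

  For two hyperplanes the intersection is found by inclusion and exclusion: for hermitian forms
  the second moment determines the number of zeros up to a sign, and the sign follows
  from the number of nonzero zeros being divisible by \<open>t\<^sup>2 - 1\<close>.
\<close>

section \<open>Finite fields of square order\<close>

text \<open>Multiplication by a nonzero \<open>x\<close> permutes the nonzero elements, so their
  product absorbs the factor \<open>x ^ (CARD('a) - 1)\<close>.\<close>

lemma finite_field_power_card:
  fixes x :: "'a::{field,finite}"
  shows "x ^ CARD('a) = x"
proof (cases "x = 0")
  case False
  have "(\<Prod>y\<in>UNIV-{0}. y) = (\<Prod>y\<in>UNIV-{0}. x * y)"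
    by (rule prod.reindex_bij_witness[of _ "\<lambda>y. x * y" "\<lambda>y. y / x"]) (use False in auto)
  also have "\<dots> = x ^ (CARD('a) - 1) * (\<Prod>y\<in>UNIV-{0}. y)"
    by (simp add: prod.distrib)
  finally have "x ^ (CARD('a) - 1) = 1"
    by simp
  then have "x * x ^ (CARD('a) - 1) = x" by simp
  then show ?thesis
    by (metis Suc_diff_1 power_Suc zero_less_card_finite)
qed simp

text \<open>Translation by 1 permutes the field, so the sum of all elements is unchanged when every
  summand grows by 1.\<close>

lemma of_nat_card_field: "of_nat CARD('a::{field,finite}) = (0 :: 'a)"
proof -
  have "(\<Sum>x\<in>UNIV. x :: 'a) = (\<Sum>x\<in>UNIV. x + 1)"
    by (rule sum.reindex_bij_witness[of _ "\<lambda>x. x + 1" "\<lambda>x. x - 1"]) auto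
  then show ?thesis by (simp add: sum.distrib)
qed

text \<open>Nonempty fibres of an additive map are translates of each other. Closure under
  differences makes \<open>S\<close> an additive subgroup. The map will be the trace, a polar
  functional into \<open>Ft\<close>, or a linear functional.\<close>

lemma card_fibre:
  fixes g :: "'v::ab_group_add \<Rightarrow> 'b::ab_group_add"
  assumes fin: "finite S" and diff: "\<And>x y. x \<in> S \<Longrightarrow> y \<in> S \<Longrightarrow> x - y \<in> S"
    and add: "\<And>x y. x \<in> S \<Longrightarrow> y \<in> S \<Longrightarrow> g (x - y) = g x - g y"
    and c: "c \<in> g ` S"
  shows "card {x \<in> S. g x = c} * card (g ` S) = card S"
proof -
  obtain x0 where x0: "x0 \<in> S" "g x0 = c" using c by auto
  have 0: "0 \<in> S" using diff[OF x0(1) x0(1)] by simp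
  have plus: "x + y \<in> S" "g (x + y) = g x + g y" if "x \<in> S" "y \<in> S" for x y
  proof -
    have n: "0 - y \<in> S" using diff 0 that by blast
    then show "x + y \<in> S" using diff[OF that(1) n] by simp
    have "g 0 = 0" using add[OF 0 0] by simp
    then show "g (x + y) = g x + g y"
      using add[OF that(1) n] add[OF 0 that(2)] by simp
  qed
  have eq: "card {x \<in> S. g x = g y} = card {x \<in> S. g x = c}" if "y \<in> S" for y
  proof (rule bij_betw_same_card, rule bij_betwI)
    show "(\<lambda>x. x - y + x0) \<in> {x \<in> S. g x = g y} \<rightarrow> {x \<in> S. g x = c}"
      using that x0 by (simp add: plus diff add)
    show "(\<lambda>x. x - x0 + y) \<in> {x \<in> S. g x = c} \<rightarrow> {x \<in> S. g x = g y}"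
      using that x0 by (simp add: plus diff add)
  qed simp_all
  have "card S = (\<Sum>d\<in>g ` S. card {x \<in> S. g x = d})"
    by (subst card_eq_sum, subst sum.image_gen[OF fin, of _ g]) (simp flip: card_eq_sum)
  also have "\<dots> = (\<Sum>d\<in>g ` S. card {x \<in> S. g x = c})"
    using eq by (intro sum.cong) auto
  finally show ?thesis by (simp add: mult.commute)
qed

text \<open>One family of polynomials covers the equation of the subfield, the kernel of the trace,
  the fibres of the norm and quadratics in one variable.\<close>

lemma card_power_eq_le:
  fixes a b :: "'a::{field,finite}" and n :: nat
  assumes "1 < n"
  shows "card {x. x ^ n + a * x + b = 0} \<le> n"
proof -
  let ?p = "monom 1 n + [:b, a:]"
  have d: "degree ?p = n"
    by (subst degree_add_eq_left) (use assms in \<open>auto simp: degree_monom_eq\<close>)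
  then have "?p \<noteq> 0" using assms by auto
  from card_poly_roots_bound[OF this] d show ?thesis
    by (simp add: poly_monom algebra_simps)
qed

section \<open>Frobenius, trace and norm over the subfield of order \<open>t\<close>\<close>

locale hermitian_field =
  fixes t :: nat and ty :: "'a::{field,finite} itself"
  assumes primepow: "primepow t" and card_field: "CARD('a) = t ^ 2"
begin

lemma t_ge_2: "t \<ge> 2"
  using primepow_gt_Suc_0[OF primepow] by simp

lemma frobenius_sum: "(sum f A) ^ t = (\<Sum>i\<in>A. (f i :: 'a) ^ t)"
  and frobenius_add: "(x + y :: 'a) ^ t = x ^ t + y ^ t"
proof -
  obtain p k where p: "prime p" and k: "t = p ^ k"
    using primepow by (auto simp: primepow_def)
  \<comment> \<open>The order of the field vanishes in it, so the prime below \<open>t\<close> is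
    the characteristic and taking \<open>t\<close>-th powers is additive.\<close>
  have "of_nat (t ^ 2) = (0::'a)"
    using of_nat_card_field[where 'a='a] by (simp only: card_field)
  then have "of_nat p = (0::'a)" by (simp add: k)
  then have "CHAR('a) dvd p" by (simp add: of_nat_eq_0_iff_char_dvd)
  then have ch: "CHAR('a) = p"
    using p by (metis CHAR_not_1' One_nat_def prime_nat_iff)
  show "(sum f A) ^ t = (\<Sum>i\<in>A. (f i :: 'a) ^ t)"
    by (rule freshmans_dream_sum'[of t k]) (use ch p k in auto)
  show "(x + y :: 'a) ^ t = x ^ t + y ^ t"
    by (rule freshmans_dream'[of t k]) (use ch p k in auto)
qed

lemma frobenius_diff: "(x - y :: 'a) ^ t = x ^ t - y ^ t"
  using frobenius_add[of "x - y" y] by (simp add: algebra_simps)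

lemma frobenius_minus: "(- y :: 'a) ^ t = - (y ^ t)"
  using frobenius_diff[of 0 y] t_ge_2 by simp

lemma frobenius_involution [simp]: "((x :: 'a) ^ t) ^ t = x"
  using finite_field_power_card[of x] by (simp add: card_field power2_eq_square flip: power_mult)

lemma zero_power_t [simp]: "(0 :: 'a) ^ t = 0"
  using t_ge_2 by simp

definition Ft :: "'a set" where "Ft = {c. c ^ t = c}"

definition Tr :: "'a \<Rightarrow> 'a" where "Tr c = c + c ^ t"

lemma Ft_closed:
  "0 \<in> Ft" "1 \<in> Ft" "c \<in> Ft \<Longrightarrow> d \<in> Ft \<Longrightarrow> c + d \<in> Ft" "c \<in> Ft \<Longrightarrow> d \<in> Ft \<Longrightarrow> c - d \<in> Ft"
  "c \<in> Ft \<Longrightarrow> d \<in> Ft \<Longrightarrow> c * d \<in> Ft" "c \<in> Ft \<Longrightarrow> - c \<in> Ft" "c \<in> Ft \<Longrightarrow> d \<in> Ft \<Longrightarrow> c / d \<in> Ft"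
  by (auto simp: Ft_def frobenius_add frobenius_diff frobenius_minus power_mult_distrib power_divide)

lemma Tr_in_Ft: "Tr c \<in> Ft"
  by (simp add: Tr_def Ft_def frobenius_add add.commute)

lemma norm_in_Ft: "c ^ (t + 1) \<in> Ft"
  by (simp add: Ft_def power_mult_distrib mult.commute)

lemma Tr_add: "Tr (c + d) = Tr c + Tr d" and Tr_diff: "Tr (c - d) = Tr c - Tr d"
  and Tr_0 [simp]: "Tr 0 = 0"
  by (auto simp: Tr_def frobenius_add frobenius_diff)

lemma Tr_mult_Ft: "c \<in> Ft \<Longrightarrow> Tr (c * d) = c * Tr d"
  by (simp add: Tr_def Ft_def power_mult_distrib algebra_simps)

text \<open>Two root counts meet: the kernel of the trace has at most \<open>t\<close> elements, so
  its image has at least \<open>t\<close>, while \<open>Ft\<close>, which contains the image, has at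
  most \<open>t\<close>.\<close>

lemma card_Ft: "card Ft = t" and range_Tr: "range Tr = Ft"
proof -
  have le: "card Ft \<le> t"
    using card_power_eq_le[of t "- 1" 0] t_ge_2 by (simp add: Ft_def)
  have sub: "range Tr \<subseteq> Ft" using Tr_in_Ft by auto
  have "card {x \<in> UNIV. Tr x = 0} * card (range Tr) = CARD('a)"
    using rangeI[of Tr 0] by (intro card_fibre) (simp_all add: Tr_diff)
  moreover have "card {x \<in> UNIV. Tr x = 0} \<le> t"
    using card_power_eq_le[of t 1 0] t_ge_2 by (simp add: Tr_def add.commute)
  ultimately have "t * t \<le> t * card (range Tr)"
    using mult_le_mono1[of "card {x \<in> UNIV. Tr x = 0}" t "card (range Tr)"]
    unfolding card_field power2_eq_square by simp
  then have "t \<le> card (range Tr)" using t_ge_2 by simp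
  then show "range Tr = Ft"
    using le by (intro card_seteq[OF _ sub]) simp_all
  then show "card Ft = t"
    using le \<open>t \<le> card (range Tr)\<close> by simp
qed

lemma card_Tr_fibre: "c \<in> Ft \<Longrightarrow> card {x. Tr x = c} = t"
proof -
  assume "c \<in> Ft"
  then have "card {x \<in> UNIV. Tr x = c} * card (range Tr) = CARD('a)"
    by (intro card_fibre) (simp_all add: Tr_diff range_Tr)
  then show ?thesis
    using t_ge_2 by (simp add: range_Tr card_Ft card_field power2_eq_square)
qed

text \<open>A nonzero \<open>d\<close> could be absorbed into \<open>c\<close>, and the trace would
  vanish identically. This strips the trace from the conditions that define radicals.\<close>

lemma Tr_nondegenerate:
  assumes "\<And>c. Tr (c * d) = 0"
  shows "d = 0"
proof (rule ccontr)
  assume "d \<noteq> 0"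
  then have "Tr c = 0" for c using assms[of "c / d"] by simp
  then have "range Tr = {0}" by auto
  then have "Ft = {0}" by (simp only: range_Tr)
  then show False using card_Ft t_ge_2 by simp
qed

lemma card_norm_fibre_le: "card {x :: 'a. x ^ (t + 1) = c} \<le> t + 1"
  using card_power_eq_le[of "t + 1" 0 "- c"] t_ge_2 by simp

text \<open>The \<open>t ^ 2 - 1\<close> nonzero elements fall into norm fibres of size at most
  \<open>t + 1\<close>, so at least \<open>t - 1\<close> nonzero norms occur, which is all that
  \<open>Ft\<close> offers.\<close>

lemma norm_surj:
  assumes "c \<in> Ft"
  obtains a :: 'a where "a ^ (t + 1) = c"
proof -
  let ?N = "\<lambda>a :: 'a. a ^ (t + 1)"
  have sub: "?N ` (UNIV - {0}) \<subseteq> Ft - {0}" using norm_in_Ft by auto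
  have "CARD('a) - 1 = card (UNIV - {0 :: 'a})" by simp
  also have "\<dots> = (\<Sum>d\<in>?N ` (UNIV - {0}). card {x \<in> UNIV - {0}. ?N x = d})"
    by (subst card_eq_sum, subst sum.image_gen[of _ _ ?N]) (simp_all flip: card_eq_sum)
  also have "\<dots> \<le> (\<Sum>d\<in>?N ` (UNIV - {0}). t + 1)"
  proof (rule sum_mono)
    show "card {x \<in> UNIV - {0}. ?N x = d} \<le> t + 1" for d
      by (rule order.trans[OF card_mono card_norm_fibre_le[of d]]) auto
  qed
  finally have "t ^ 2 - 1 \<le> card (?N ` (UNIV - {0})) * (t + 1)" by (simp add: card_field)
  moreover have "t ^ 2 - 1 = (t - 1) * (t + 1)"
    using t_ge_2 by (simp add: power2_eq_square algebra_simps)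
  ultimately have "(t - 1) * (t + 1) \<le> card (?N ` (UNIV - {0})) * (t + 1)"
    by (simp only:)
  then have "t - 1 \<le> card (?N ` (UNIV - {0}))" by (simp only: mult_le_cancel2)
  then have "?N ` (UNIV - {0}) = Ft - {0}"
    using sub by (intro card_seteq) (auto simp: card_Ft Ft_closed)
  then have "c = 0 \<or> c \<in> ?N ` (UNIV - {0})" using assms by blast
  then show ?thesis
  proof
    assume "c = 0"
    then show ?thesis by (intro that[of 0]) simp
  qed (use that in blast)
qed

end

section \<open>Quadratic forms over the subfield\<close>

text \<open>Values and scalars lie in the subfield while \<open>W\<close> is a space over the whole
  field. This accommodates both \<open>H\<close> and its perturbations by traces, which are
  quadratic over the subfield only.\<close>

locale Ft_quadratic_form = hermitian_field t ty for t and ty :: "'a::{field,finite} itself" +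
  fixes W :: "('a ^ 5) set" and \<phi> :: "'a ^ 5 \<Rightarrow> 'a" and \<beta> :: "'a ^ 5 \<Rightarrow> 'a ^ 5 \<Rightarrow> 'a"
  assumes W: "vec.subspace W"
    and in_Ft: "x \<in> W \<Longrightarrow> \<phi> x \<in> Ft"
    and polar: "x \<in> W \<Longrightarrow> z \<in> W \<Longrightarrow> \<phi> (x + z) = \<phi> x + \<phi> z + \<beta> x z"
    and polar_diff: "x \<in> W \<Longrightarrow> y \<in> W \<Longrightarrow> z \<in> W \<Longrightarrow> \<beta> (x - y) z = \<beta> x z - \<beta> y z"
    and polar_scale: "c \<in> Ft \<Longrightarrow> x \<in> W \<Longrightarrow> z \<in> W \<Longrightarrow> \<beta> (c *s x) z = c * \<beta> x z"
begin

definition radical :: "('a ^ 5) set" where "radical = {z \<in> W. \<forall>x\<in>W. \<beta> x z = 0}"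

text \<open>This is \<open>t\<close> times the excess of a fibre over the mean fibre size
  \<open>card W / t\<close>, so that no division occurs.\<close>

definition deviation :: "'a \<Rightarrow> real" where
  "deviation c = real t * real (card {x \<in> W. \<phi> x = c}) - real (card W)"

text \<open>For \<open>z\<close> outside the radical, \<open>\<beta>\<close> with second argument
  \<open>z\<close> is a nonzero \<open>Ft\<close>-linear functional, hence onto \<open>Ft\<close>
  with fibres of equal size.\<close>

lemma polar_fibre:
  assumes z: "z \<in> W" "z \<notin> radical" and c: "c \<in> Ft"
  shows "card {x \<in> W. \<beta> x z = c} * t = card W"
proof -
  have Wd: "x - y \<in> W" if "x \<in> W" "y \<in> W" for x y
    using W that by (rule vec.subspace_diff)
  \<comment> \<open>Expressing \<open>\<beta>\<close> by values of \<open>\<phi>\<close> puts it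
    into \<open>Ft\<close>.\<close>
  have "\<beta> x z = \<phi> (x + z) - \<phi> x - \<phi> z" if "x \<in> W" for x
    using polar[OF that z(1)] by simp
  then have sub: "(\<lambda>x. \<beta> x z) ` W \<subseteq> Ft"
    using in_Ft z(1) vec.subspace_add[OF W] by (auto intro!: Ft_closed)
  obtain x where x: "x \<in> W" "\<beta> x z \<noteq> 0"
    using z by (auto simp: radical_def)
  have "d \<in> (\<lambda>x. \<beta> x z) ` W" if d: "d \<in> Ft" for d
  proof
    have e: "d / \<beta> x z \<in> Ft" using sub x d by (intro Ft_closed) auto
    show "(d / \<beta> x z) *s x \<in> W" using W x by (intro vec.subspace_scale)
    show "d = \<beta> ((d / \<beta> x z) *s x) z" using x z by (simp add: polar_scale e)
  qed
  with sub have "(\<lambda>x. \<beta> x z) ` W = Ft" by auto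
  with card_fibre[of W "\<lambda>x. \<beta> x z" c] Wd z c show ?thesis
    by (simp add: polar_diff card_Ft)
qed

section \<open>Moments of the fibre sizes\<close>

lemma sum_deviation: "(\<Sum>c\<in>Ft. deviation c) = 0"
proof -
  have "card W = (\<Sum>c\<in>Ft. card {x \<in> W. \<phi> x = c})"
    using sum.group[of W Ft \<phi> "\<lambda>_. 1::nat"] in_Ft by (simp add: image_subset_iff)
  then have "real (card W) = (\<Sum>c\<in>Ft. real (card {x \<in> W. \<phi> x = c}))" by simp
  then show ?thesis
    by (simp add: deviation_def sum_subtractf card_Ft flip: sum_distrib_left)
qed

text \<open>The left side counts pairs \<open>x\<close>, \<open>y\<close> with equal values. With
  \<open>y = x + z\<close>, equality of the values becomes \<open>\<beta> x z = - \<phi> z\<close>,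
  which is then counted for fixed \<open>z\<close>.\<close>

lemma sum_card_squared:
  "(\<Sum>c\<in>Ft. (card {x \<in> W. \<phi> x = c})\<^sup>2) = (\<Sum>z\<in>W. card {x \<in> W. \<beta> x z = - \<phi> z})"
proof -
  have "(\<Sum>c\<in>Ft. (card {x \<in> W. \<phi> x = c})\<^sup>2)
      = (\<Sum>c\<in>Ft. \<Sum>x | x \<in> W \<and> \<phi> x = c. card {y \<in> W. \<phi> y = \<phi> x})"
    by (simp add: power2_eq_square)
  also have "\<dots> = (\<Sum>x\<in>W. card {y \<in> W. \<phi> y = \<phi> x})"
    using in_Ft by (intro sum.group) auto
  also have "\<dots> = (\<Sum>x\<in>W. card {z \<in> W. \<beta> x z = - \<phi> z})"
  proof (rule sum.cong)
    fix x assume x: "x \<in> W"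
    show "card {y \<in> W. \<phi> y = \<phi> x} = card {z \<in> W. \<beta> x z = - \<phi> z}"
    proof (rule bij_betw_same_card, rule bij_betwI)
      show "(\<lambda>y. y - x) \<in> {y \<in> W. \<phi> y = \<phi> x} \<rightarrow> {z \<in> W. \<beta> x z = - \<phi> z}"
      proof safe
        fix y assume y: "y \<in> W" "\<phi> y = \<phi> x"
        then show "y - x \<in> W" using W x vec.subspace_diff by blast
        then show "\<beta> x (y - x) = - \<phi> (y - x)"
          using polar[OF x, of "y - x"] y by (simp add: algebra_simps eq_neg_iff_add_eq_0)
      qed
      show "(\<lambda>z. x + z) \<in> {z \<in> W. \<beta> x z = - \<phi> z} \<rightarrow> {y \<in> W. \<phi> y = \<phi> x}"
        using W x by (auto simp: polar vec.subspace_add)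
    qed simp_all
  qed simp
  also have "\<dots> = (\<Sum>x\<in>W. \<Sum>z\<in>W. if \<beta> x z = - \<phi> z then 1 else 0)"
    by (simp add: sum.If_cases Int_def)
  also have "\<dots> = (\<Sum>z\<in>W. \<Sum>x\<in>W. if \<beta> x z = - \<phi> z then 1 else 0)"
    by (rule sum.swap)
  also have "\<dots> = (\<Sum>z\<in>W. card {x \<in> W. \<beta> x z = - \<phi> z})"
    by (simp add: sum.If_cases Int_def)
  finally show ?thesis .
qed

text \<open>In \<open>sum_card_squared\<close>, a \<open>z\<close> outside the radical contributes
  \<open>card W / t\<close> by \<open>polar_fibre\<close>; a \<open>z\<close> in the radical
  contributes \<open>card W\<close> if \<open>\<phi> z = 0\<close> and nothing otherwise.\<close>

lemma second_moment:
  "(\<Sum>c\<in>Ft. (deviation c)\<^sup>2)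
     = real t * real (card W) * (real t * real (card {z \<in> radical. \<phi> z = 0}) - real (card radical))"
proof -
  let ?n = "real (card W)" and ?K0 = "{z \<in> radical. \<phi> z = 0}"
  have sub: "radical \<subseteq> W" "?K0 \<subseteq> radical" by (auto simp: radical_def)
  have K: "{x \<in> W. \<beta> x z = - \<phi> z} = (if \<phi> z = 0 then W else {})" if "z \<in> radical" for z
    using that by (auto simp: radical_def)
  have "(\<Sum>z\<in>W. real t * real (card {x \<in> W. \<beta> x z = - \<phi> z}))
      = (\<Sum>z\<in>radical. real t * real (card {x \<in> W. \<beta> x z = - \<phi> z}))
      + (\<Sum>z\<in>W - radical. real t * real (card {x \<in> W. \<beta> x z = - \<phi> z}))"
    by (subst sum.subset_diff[OF sub(1)]) simp_all
  also have "(\<Sum>z\<in>radical. real t * real (card {x \<in> W. \<beta> x z = - \<phi> z}))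
      = (\<Sum>z\<in>radical. if \<phi> z = 0 then real t * ?n else 0)"
    by (intro sum.cong) (simp_all add: K)
  also have "\<dots> = real (card ?K0) * (real t * ?n)"
    by (simp add: sum.If_cases Int_def)
  also have "(\<Sum>z\<in>W - radical. real t * real (card {x \<in> W. \<beta> x z = - \<phi> z}))
      = (\<Sum>z\<in>W - radical. ?n)"
  proof (rule sum.cong)
    fix z assume z: "z \<in> W - radical"
    then have *: "card {x \<in> W. \<beta> x z = - \<phi> z} * t = card W"
      by (intro polar_fibre Ft_closed in_Ft) simp_all
    show "real t * real (card {x \<in> W. \<beta> x z = - \<phi> z}) = ?n"
      unfolding *[symmetric] of_nat_mult by (rule mult.commute)
  qed simp
  also have "\<dots> = (?n - real (card radical)) * ?n"
    using sub by (simp add: card_Diff_subset card_mono of_nat_diff)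
  finally have a: "(\<Sum>z\<in>W. real t * real (card {x \<in> W. \<beta> x z = - \<phi> z}))
      = real (card ?K0) * (real t * ?n) + (?n - real (card radical)) * ?n" .
  have "(\<Sum>c\<in>Ft. (real (card {x \<in> W. \<phi> x = c}))\<^sup>2)
      = real (\<Sum>z\<in>W. card {x \<in> W. \<beta> x z = - \<phi> z})"
    unfolding sum_card_squared[symmetric] by simp
  then have 1: "real t * (\<Sum>c\<in>Ft. (real (card {x \<in> W. \<phi> x = c}))\<^sup>2)
      = real (card ?K0) * (real t * ?n) + (?n - real (card radical)) * ?n"
    unfolding a[symmetric] by (simp only: of_nat_sum sum_distrib_left)
  have 2: "(deviation c)\<^sup>2 = real t ^ 2 * (real (card {x \<in> W. \<phi> x = c}))\<^sup>2
      - 2 * ?n * deviation c - ?n ^ 2" for c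
    by (simp add: deviation_def power2_eq_square algebra_simps)
  have "(\<Sum>c\<in>Ft. (deviation c)\<^sup>2)
     = real t * (real t * (\<Sum>c\<in>Ft. (real (card {x \<in> W. \<phi> x = c}))\<^sup>2)) - real t * ?n ^ 2"
    by (simp only: 2 sum_subtractf sum_distrib_left[symmetric] sum_deviation)
       (simp add: card_Ft power2_eq_square)
  then show ?thesis
    unfolding 1 by (simp add: power2_eq_square algebra_simps)
qed

lemma deviation_0: "deviation 0 = - (\<Sum>c\<in>Ft - {0}. deviation c)"
  using sum_deviation sum.remove[of Ft 0 deviation] by (simp add: Ft_closed)

text \<open>The deviation at 0 is minus the sum of the other \<open>t - 1\<close> deviations.
  Cauchy-Schwarz bounds its square by the second moment, where the zeros of \<open>\<phi>\<close> in
  the radical are at most the whole radical.\<close>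

lemma deviation_bound: "(deviation 0)\<^sup>2 \<le> (real t - 1)\<^sup>2 * (real (card W) * real (card radical))"
proof -
  let ?n = "real (card W)" and ?k = "real (card radical)"
  have t: "real t \<ge> 2" using t_ge_2 by simp
  have "(deviation 0)\<^sup>2 \<le> (real t - 1) * (\<Sum>c\<in>Ft - {0}. (deviation c)\<^sup>2)"
    using Cauchy_Schwarz_ineq_sum[of "\<lambda>_. 1" deviation "Ft - {0}"] t_ge_2
    by (simp add: deviation_0 card_Ft Ft_closed of_nat_diff)
  also have "(\<Sum>c\<in>Ft - {0}. (deviation c)\<^sup>2) = (\<Sum>c\<in>Ft. (deviation c)\<^sup>2) - (deviation 0)\<^sup>2"
    by (subst sum.remove[of Ft 0]) (simp_all add: Ft_closed)
  finally have "real t * (deviation 0)\<^sup>2 \<le> (real t - 1) * (\<Sum>c\<in>Ft. (deviation c)\<^sup>2)"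
    by (simp add: algebra_simps)
  also have "(\<Sum>c\<in>Ft. (deviation c)\<^sup>2) \<le> real t * ?n * (real t * ?k - ?k)"
    unfolding second_moment
    by (intro mult_left_mono diff_right_mono) (simp_all add: card_mono)
  then have "(real t - 1) * (\<Sum>c\<in>Ft. (deviation c)\<^sup>2)
      \<le> (real t - 1) * (real t * ?n * (real t * ?k - ?k))"
    using t by (intro mult_left_mono) simp_all
  also have "\<dots> = real t * ((real t - 1)\<^sup>2 * (?n * ?k))"
    by (simp add: algebra_simps power2_eq_square)
  finally show ?thesis using t by (simp only: mult_le_cancel_left_pos)
qed

text \<open>This is the equality case of \<open>deviation_bound\<close>: equal deviations at the
  nonzero values make Cauchy-Schwarz sharp, and the whole radical consists of zeros.\<close>

lemma deviation_exact:
  assumes const: "\<And>c. c \<in> Ft - {0} \<Longrightarrow> deviation c = deviation 1"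
    and iso: "\<And>z. z \<in> radical \<Longrightarrow> \<phi> z = 0"
  shows "(deviation 0)\<^sup>2 = (real t - 1)\<^sup>2 * (real (card W) * real (card radical))"
proof -
  let ?n = "real (card W)" and ?k = "real (card radical)"
  have t: "real t \<ge> 2" using t_ge_2 by simp
  have sum: "(\<Sum>c\<in>Ft - {0}. f (deviation c)) = (real t - 1) * f (deviation 1)" for f :: "real \<Rightarrow> real"
  proof -
    have "(\<Sum>c\<in>Ft - {0}. f (deviation c)) = (\<Sum>c\<in>Ft - {0}. f (deviation 1))"
      using const by (intro sum.cong) auto
    then show ?thesis using t_ge_2 by (simp add: card_Ft Ft_closed of_nat_diff)
  qed
  have 0: "deviation 0 = - ((real t - 1) * deviation 1)"
    using deviation_0 sum[of "\<lambda>x. x"] by simp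
  have "{z \<in> radical. \<phi> z = 0} = radical" using iso by auto
  then have "real t * ?n * (real t * ?k - ?k) = (\<Sum>c\<in>Ft. (deviation c)\<^sup>2)"
    using second_moment by simp
  also have "\<dots> = (deviation 0)\<^sup>2 + (\<Sum>c\<in>Ft - {0}. (deviation c)\<^sup>2)"
    by (subst sum.remove[of Ft 0]) (simp_all add: Ft_closed)
  also have "\<dots> = real t * (real t - 1) * (deviation 1)\<^sup>2"
    unfolding 0 using sum[of "\<lambda>x. x\<^sup>2"] by (simp add: power2_eq_square algebra_simps)
  finally have "real t * (real t - 1) * (deviation 1)\<^sup>2 = real t * (real t - 1) * (?n * ?k)"
    by (simp add: algebra_simps)
  then have "(deviation 1)\<^sup>2 = ?n * ?k" using t by simp
  then show ?thesis unfolding 0 by (simp add: power_mult_distrib)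
qed

end

section \<open>Hermitian forms on subspaces\<close>

lemma card_add_line:
  fixes S :: "('a::{field,finite} ^ 'n) set"
  assumes S: "vec.subspace S" and w: "w \<notin> S"
  shows "card {x. \<exists>c. x - c *s w \<in> S} = CARD('a) * card S"
proof -
  have "card {x. \<exists>c. x - c *s w \<in> S} = card ((\<lambda>(c, y). c *s w + y) ` (UNIV \<times> S))"
  proof (rule arg_cong[where f=card], intro equalityI subsetI)
    fix x assume "x \<in> {x. \<exists>c. x - c *s w \<in> S}"
    then obtain c where "x - c *s w \<in> S" by blast
    then show "x \<in> (\<lambda>(c, y). c *s w + y) ` (UNIV \<times> S)"
      by (intro image_eqI[of _ _ "(c, x - c *s w)"]) simp_all
  next
    fix x assume "x \<in> (\<lambda>(c, y). c *s w + y) ` (UNIV \<times> S)"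
    then obtain c y where "x = c *s w + y" "y \<in> S" by auto
    then have "x - c *s w \<in> S" by simp
    then show "x \<in> {x. \<exists>c. x - c *s w \<in> S}" by blast
  qed
  also have "\<dots> = card ((UNIV :: 'a set) \<times> S)"
  proof (rule card_image)
    have inj: "c = c' \<and> y = y'"
      if y: "y \<in> S" "y' \<in> S" and eq: "c *s w + y = c' *s w + y'" for c c' y y'
    proof -
      have "(c - c') *s w = y' - y"
        using eq by (simp add: vector_sub_rdistrib algebra_simps)
      then have in_S: "(c - c') *s w \<in> S" using vec.subspace_diff[OF S y(2,1)] by simp
      have "c = c'"
      proof (rule ccontr)
        assume "c \<noteq> c'"
        then have "inverse (c - c') *s ((c - c') *s w) = w"
          by (simp only: vec.scale_scale) simp
        then show False using vec.subspace_scale[OF S in_S, of "inverse (c - c')"] w by simp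
      qed
      with eq show ?thesis by simp
    qed
    show "inj_on (\<lambda>(c, y). c *s w + y) (UNIV \<times> S)"
      by (rule inj_onI) (auto dest: inj)
  qed
  finally show ?thesis by simp
qed

lemma card_subspace:
  fixes S :: "('a::{field,finite} ^ 'n) set"
  assumes "vec.subspace S"
  shows "card S = CARD('a) ^ vec.dim S"
proof -
  have span: "card (vec.span B) = CARD('a) ^ card B" if "vec.independent B" for B :: "('a ^ 'n) set"
    using finite[of B] that
  proof (induction B)
    case (insert b B)
    then have "vec.independent B" "b \<notin> vec.span B"
      by (auto simp: vec.independent_insert)
    then show ?case
      using insert card_add_line[of "vec.span B" b]
      by (simp add: vec.span_insert vec.subspace_span)
  qed simp
  obtain B where B: "B \<subseteq> S" "vec.independent B" "S \<subseteq> vec.span B" "card B = vec.dim S"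
    using vec.basis_exists[of S] by blast
  then have "vec.span B = S"
    using assms vec.span_minimal by blast
  then show ?thesis using span[OF B(2)] B(4) by simp
qed

text \<open>A nonzero functional is onto, so \<open>CARD('a)\<close> times the size of its kernel is
  the size of the space; the dimension is read off from that cardinality.\<close>

lemma hyperplane_kernel:
  fixes g :: "'a::{field,finite} ^ 5 \<Rightarrow> 'a"
  assumes add: "\<And>x y. g (x + y) = g x + g y" and scale: "\<And>c x. g (c *s x) = c * g x"
    and y: "g y \<noteq> 0"
  shows "hyperplane {x. g x = 0}"
proof -
  let ?U = "{x. g x = 0}"
  have sub: "vec.subspace ?U"
    using scale[of 0 0] by (simp add: vec.subspace_def add scale)
  have "g (x - z) = g x - g z" for x z
    using add[of "x - z" z] by simp
  moreover have r: "range g = UNIV"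
  proof (rule surjI)
    show "g ((c / g y) *s y) = c" for c using y by (simp add: scale)
  qed
  ultimately have "card {x \<in> UNIV. g x = 0} * card (range g) = CARD('a ^ 5)"
    by (intro card_fibre) simp_all
  then have "CARD('a) ^ Suc (vec.dim ?U) = CARD('a) ^ 5"
    using card_subspace[OF sub] by (simp add: r mult.commute)
  moreover have "CARD('a) > 1"
    using card_mono[of UNIV "{0, 1 :: 'a}"] by simp
  ultimately have "Suc (vec.dim ?U) = 5" by (simp only: power_inject_exp)
  then show ?thesis using sub by (simp add: hyperplane_def)
qed

text \<open>Projective points partition the nonzero vectors of a cone into classes of size
  \<open>CARD('a) - 1\<close>; the summand 1 is the zero vector.\<close>

lemma card_projective_points:
  fixes A :: "('a::{field,finite} ^ 5) set"
  assumes 0: "0 \<in> A" and scale: "\<And>c x. x \<in> A \<Longrightarrow> c *s x \<in> A"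
  shows "card A = 1 + (CARD('a) - 1) * card {P \<in> points. P \<subseteq> A}"
proof -
  let ?\<P> = "{P \<in> points. P \<subseteq> A}"
  have "A - {0} = (\<Union>P\<in>?\<P>. P - {0})"
  proof (intro equalityI subsetI)
    fix x assume x: "x \<in> A - {0}"
    have "vec.span {x} \<subseteq> A"
      using x scale unfolding vec.span_singleton by blast
    moreover have "vec.span {x} \<in> points"
      using x by (simp add: points_def vec.subspace_span)
    moreover have "x \<in> vec.span {x}" by (simp add: vec.span_base)
    ultimately show "x \<in> (\<Union>P\<in>?\<P>. P - {0})" using x by blast
  qed blast
  then have "card (A - {0}) = card (\<Union>P\<in>?\<P>. P - {0})" by (rule arg_cong)
  also have "\<dots> = (\<Sum>P\<in>?\<P>. card (P - {0}))"
  proof (rule card_UN_disjoint)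
    show "\<forall>P\<in>?\<P>. \<forall>Q\<in>?\<P>. P \<noteq> Q \<longrightarrow> (P - {0}) \<inter> (Q - {0}) = {}"
    proof (intro ballI impI, rule ccontr)
      fix P Q assume PQ: "P \<in> ?\<P>" "Q \<in> ?\<P>" "P \<noteq> Q"
      assume "(P - {0}) \<inter> (Q - {0}) \<noteq> {}"
      then obtain x where x: "x \<in> P" "x \<in> Q" "x \<noteq> 0" by blast
      have "P = range (\<lambda>c. c *s x)"
        using PQ(1) x by (intro points_eq_multiples) simp_all
      moreover have "Q = range (\<lambda>c. c *s x)"
        using PQ(2) x by (intro points_eq_multiples) simp_all
      ultimately show False using PQ(3) by simp
    qed
  qed (rule finite ballI)+
  also have "\<dots> = (\<Sum>P\<in>?\<P>. CARD('a) - 1)"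
  proof (rule sum.cong)
    fix P assume "P \<in> ?\<P>"
    then have P: "vec.subspace P" "vec.dim P = 1" by (simp_all add: points_def)
    show "card (P - {0}) = CARD('a) - 1"
      using card_subspace[OF P(1)] vec.subspace_0[OF P(1)] P(2) by simp
  qed simp
  also have "\<dots> = (CARD('a) - 1) * card ?\<P>" by simp
  finally have "card (A - {0}) = (CARD('a) - 1) * card ?\<P>" .
  moreover have "card A = Suc (card (A - {0}))"
    using 0 by (rule card.remove[OF finite])
  ultimately show ?thesis by (simp only: plus_1_eq_Suc)
qed

section \<open>Isotropic vectors of the hermitian form on a subspace\<close>

context hermitian_field
begin

definition H :: "'a ^ 5 \<Rightarrow> 'a" where "H x = (\<Sum>i\<in>UNIV. (x $ i) ^ (t + 1))"

abbreviation h :: "'a ^ 5 \<Rightarrow> 'a ^ 5 \<Rightarrow> 'a" where "h \<equiv> herm_form t"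

lemma H_eq: "H x = h x x"
  by (simp add: H_def herm_form_def)

lemma h_add_left: "h (x + y) z = h x z + h y z" and h_diff_left: "h (x - y) z = h x z - h y z"
  and h_add_right: "h z (x + y) = h z x + h z y"
  and h_scale_left: "h (c *s x) z = c * h x z" and h_scale_right: "h z (c *s x) = c ^ t * h z x"
  by (simp_all add: herm_form_def frobenius_add algebra_simps sum.distrib sum_subtractf
      sum_distrib_left power_mult_distrib)

lemma h_0_left [simp]: "h 0 z = 0"
  using h_scale_left[of 0 0] by simp

lemma h_swap: "h y x = (h x y) ^ t"
  by (simp add: herm_form_def frobenius_sum power_mult_distrib mult.commute)

lemma h_eq_0_swap: "h y x = 0 \<longleftrightarrow> h x y = 0"
  by (metis h_swap frobenius_involution zero_power_t)

lemma h_axis: "h (axis j c) z = c * (z $ j) ^ t"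
  by (simp add: herm_form_def axis_def if_distrib[of "\<lambda>a. a * _"] cong: if_cong)

lemma H_in_Ft: "H x \<in> Ft"
  using h_swap[of x x] by (simp add: Ft_def H_eq)

lemma H_add: "H (x + z) = H x + H z + Tr (h x z)"
  by (simp add: H_eq h_add_left h_add_right Tr_def h_swap[of z x])

lemma H_scale: "H (c *s x) = c ^ (t + 1) * H x"
  by (simp add: H_eq h_scale_left h_scale_right)

lemma H_0 [simp]: "H 0 = 0"
  using H_scale[of 0 0] by simp

lemma subspace_herm_radical:
  fixes W :: "('a ^ 5) set"
  shows "vec.subspace W \<Longrightarrow> vec.subspace (herm_radical t W)"
  unfolding herm_radical_def vec.subspace_def
  by (simp add: h_add_left h_scale_left)

lemma card_isotropic_points:
  "card {x. H x = 0 \<and> x \<in> A} = 1 + (t ^ 2 - 1) * card {P \<in> herm_variety t. P \<subseteq> A}"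
  if "0 \<in> A" "\<And>c x. x \<in> A \<Longrightarrow> c *s x \<in> A" for A :: "('a ^ 5) set"
proof -
  have "{P \<in> herm_variety t. P \<subseteq> A} = {P \<in> points. P \<subseteq> {x. H x = 0 \<and> x \<in> A}}"
    by (auto simp: herm_variety_def H_def)
  then show ?thesis
    using card_projective_points[of "{x. H x = 0 \<and> x \<in> A}"] that
    by (simp add: card_field H_scale)
qed

lemma Ft_quadratic_form_H:
  assumes "vec.subspace W"
  shows "Ft_quadratic_form t W H (\<lambda>x z. Tr (h x z))"
proof unfold_locales
qed (use assms in \<open>simp_all add: H_in_Ft H_add h_diff_left Tr_diff h_scale_left Tr_mult_Ft\<close>)

text \<open>Nonzero values of \<open>H\<close> are norms and can be scaled to 1, so
  \<open>deviation_exact\<close> yields the square of the deviation. The count of projective points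
  modulo \<open>t ^ 2 - 1\<close> fixes the sign.\<close>

theorem card_isotropic:
  assumes W: "vec.subspace W"
  defines "m \<equiv> vec.dim W" and "s \<equiv> vec.dim (herm_radical t W)"
  shows "int t * int (card {x \<in> W. H x = 0}) = int t ^ (2 * m) + (- 1) ^ (m + s) * (int t - 1) * int t ^ (m + s)"
proof -
  interpret Ft_quadratic_form t ty W H "\<lambda>x z. Tr (h x z)"
    using W by (rule Ft_quadratic_form_H)
  let ?Z = "card {x \<in> W. H x = 0}" and ?k = "m + s"
  have "radical = herm_radical t W"
  proof (intro equalityI subsetI)
    fix z assume z: "z \<in> radical"
    \<comment> \<open>\<open>W\<close> is closed under all scalars of the field, so any
      \<open>c\<close> may be put inside the trace.\<close>
    have "h z x = 0" if x: "x \<in> W" for x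
    proof -
      have "Tr (c * h x z) = 0" for c
        using z vec.subspace_scale[OF W x, of c] by (auto simp: radical_def simp flip: h_scale_left)
      then have "h x z = 0" by (rule Tr_nondegenerate)
      then show ?thesis by (simp add: h_eq_0_swap)
    qed
    with z show "z \<in> herm_radical t W" by (simp add: radical_def herm_radical_def)
  next
    fix z assume "z \<in> herm_radical t W"
    then show "z \<in> radical"
      using h_eq_0_swap[of z] by (auto simp: radical_def herm_radical_def)
  qed
  then have card_radical: "card radical = t ^ (2 * s)"
    using card_subspace[OF subspace_herm_radical[OF W]] by (simp add: s_def card_field power_mult)
  have card_W: "card W = t ^ (2 * m)"
    using card_subspace[OF W] by (simp add: m_def card_field power_mult)
  have "(deviation 0)\<^sup>2 = (real t - 1)\<^sup>2 * (real (card W) * real (card radical))"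
  proof (rule deviation_exact)
    fix c assume c: "c \<in> Ft - {0}"
    \<comment> \<open>Division by a scalar of norm \<open>c\<close> carries the vectors of value
      \<open>c\<close> to those of value 1.\<close>
    then obtain a where a: "a ^ (t + 1) = c" using norm_surj by blast
    with c have "a \<noteq> 0" by auto
    have "card {x \<in> W. H x = c} = card {x \<in> W. H x = 1}"
    proof (rule bij_betw_same_card, rule bij_betwI)
      show "(\<lambda>x. inverse a *s x) \<in> {x \<in> W. H x = c} \<rightarrow> {x \<in> W. H x = 1}"
      proof safe
        fix x assume x: "x \<in> W" "c = H x"
        then show "inverse a *s x \<in> W" by (intro vec.subspace_scale[OF W])
        show "H (inverse a *s x) = 1"
          unfolding H_scale power_inverse a using c x by simp
      qed
      show "(\<lambda>x. a *s x) \<in> {x \<in> W. H x = 1} \<rightarrow> {x \<in> W. H x = c}"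
        using a by (auto simp: vec.subspace_scale[OF W] H_scale)
    qed (use \<open>a \<noteq> 0\<close> in simp_all)
    then show "deviation c = deviation 1" by (simp add: deviation_def)
  next
    fix z assume "z \<in> radical"
    then show "H z = 0" using \<open>radical = herm_radical t W\<close> by (simp add: herm_radical_def H_eq)
  qed
  also have "\<dots> = ((real t - 1) * real t ^ ?k)\<^sup>2"
    by (simp add: card_W card_radical power_mult_distrib power_add power_mult power2_eq_square)
  finally have "(real_of_int (int t * int ?Z - int t ^ (2 * m)))\<^sup>2 = (real_of_int ((int t - 1) * int t ^ ?k))\<^sup>2"
    by (simp add: deviation_def card_W)
  then have "(int t * int ?Z - int t ^ (2 * m))\<^sup>2 = ((int t - 1) * int t ^ ?k)\<^sup>2"
    by (simp only: of_int_eq_iff flip: of_int_power)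
  \<comment> \<open>With \<open>(- 1) ^ ?k\<close> factored out, the first case is the claim and the
    second is the wrong sign, whatever the parity of \<open>?k\<close>.\<close>
  then consider "int t * int ?Z - int t ^ (2 * m) = (- 1) ^ ?k * ((int t - 1) * int t ^ ?k)"
    | "int t * int ?Z - int t ^ (2 * m) = - ((- 1) ^ ?k * ((int t - 1) * int t ^ ?k))"
    by (cases "even ?k") (auto simp: power2_eq_iff)
  then show ?thesis
  proof cases
    case 2
    let ?d = "int t ^ 2 - 1"
    have t: "int t \<ge> 2" using t_ge_2 by simp
    have sq: "?d dvd int t ^ (2 * n) - 1" for n
    proof -
      have "int t ^ (2 * n) - 1 = ?d * (\<Sum>i<n. (int t ^ 2) ^ i)"
        using power_diff_1_eq[of "int t ^ 2" n] by (simp add: power_mult)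
      then show ?thesis by simp
    qed
    have "int ?Z - 1 = ?d * int (card {P \<in> herm_variety t. P \<subseteq> W})"
      using card_isotropic_points[of W] W t_ge_2
      by (simp add: vec.subspace_0 vec.subspace_scale conj_commute of_nat_diff)
    then have "?d dvd int t * (int ?Z - 1)" by simp
    then have "?d dvd int t * (int ?Z - 1) - (int t ^ (2 * m) - 1)"
      using sq by (rule dvd_diff)
    moreover have "int t * (int ?Z - 1) - (int t ^ (2 * m) - 1)
        = (int t * int ?Z - int t ^ (2 * m)) + 1 - int t"
      by (simp add: algebra_simps)
    ultimately have 1: "?d dvd - ((- 1) ^ ?k * ((int t - 1) * int t ^ ?k)) + 1 - int t"
      unfolding 2 by (simp only:)
    \<comment> \<open>Even powers of \<open>t\<close> are 1 modulo \<open>t ^ 2 - 1\<close>, so for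
      either parity the wrong sign leaves \<open>2 * (t - 1)\<close>. Then \<open>t + 1\<close>
      would divide 2.\<close>
    have "?d dvd 2 * (int t - 1)"
    proof (cases "even ?k")
      case True
      then obtain j where j: "?k = 2 * j" by (elim evenE)
      have "?d dvd (int t - 1) * (int t ^ (2 * j) - 1)" using sq by simp
      from dvd_add[OF 1 this] have "?d dvd - (2 * (int t - 1))"
        unfolding j by (simp add: algebra_simps)
      then show ?thesis by (simp only: dvd_minus_iff)
    next
      case False
      then obtain j where j: "?k = 2 * j + 1" by (elim oddE)
      have "?d dvd (int t - 1) * int t * (int t ^ (2 * j) - 1)" using sq by simp
      from dvd_diff[OF 1 this] have "?d dvd (int t ^ 2 - 1) - 2 * (int t - 1)"
        unfolding j by (simp add: algebra_simps power2_eq_square)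
      then have "?d dvd (int t ^ 2 - 1) - ((int t ^ 2 - 1) - 2 * (int t - 1))"
        by (rule dvd_diff[OF dvd_refl])
      then show ?thesis by simp
    qed
    moreover have "?d = (int t + 1) * (int t - 1)"
      by (simp add: power2_eq_square algebra_simps)
    ultimately have "(int t + 1) * (int t - 1) dvd 2 * (int t - 1)" by (simp only:)
    then have "int t + 1 dvd 2" using t by (simp only: dvd_mult_cancel_right) simp
    then have "int t + 1 \<le> 2" by (rule zdvd_imp_le) simp
    then show ?thesis using t by simp
  qed (simp add: mult.assoc)
qed

end

section \<open>Sections by hyperplanes\<close>

lemma subspace_extend_by_line:
  fixes S T :: "('a::{field,finite} ^ 'n) set"
  assumes S: "vec.subspace S" and T: "vec.subspace T" and "S \<subseteq> T"
    and dim: "vec.dim T = Suc (vec.dim S)"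
  obtains w where "T = {x. \<exists>c. x - c *s w \<in> S}"
proof -
  have "S \<noteq> T" using dim by auto
  with \<open>S \<subseteq> T\<close> obtain w where w: "w \<in> T" "w \<notin> S" by blast
  let ?A = "{x. \<exists>c. x - c *s w \<in> S}"
  have "?A \<subseteq> T"
  proof
    fix x assume "x \<in> ?A"
    then obtain c where "x - c *s w \<in> T" using \<open>S \<subseteq> T\<close> by blast
    from vec.subspace_add[OF T this vec.subspace_scale[OF T w(1), of c]]
    show "x \<in> T" by simp
  qed
  moreover have "card ?A = card T"
    unfolding card_add_line[OF S w(2)] card_subspace[OF S] card_subspace[OF T] dim by simp
  ultimately have "?A = T" by (intro card_subset_eq) simp_all
  then show ?thesis using that by blast
qed

section \<open>Radicals, tangency and the sizes of linear sections\<close>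

context hermitian_field
begin

lemma h_nondegenerate:
  assumes "\<And>x. h z x = 0"
  shows "z = 0"
proof -
  have "z $ j = 0" for j
  proof -
    have "h (axis j 1) z = 0" using assms h_eq_0_swap by blast
    then show ?thesis using t_ge_2 by (simp add: h_axis)
  qed
  then show ?thesis by (simp add: vec_eq_iff)
qed

text \<open>Let \<open>w\<close> complete \<open>B\<close> to \<open>A\<close>. Two radical vectors
  of \<open>B\<close> with the same product with \<open>w\<close> differ by a vector orthogonal to
  all of \<open>A\<close>, hence coincide; so the radical embeds into the field.\<close>

lemma dim_radical_hyperplane:
  fixes A B :: "('a ^ 5) set"
  assumes B: "vec.subspace B" and A: "vec.subspace A" and "B \<subseteq> A"
    and dim: "vec.dim A = Suc (vec.dim B)" and rad: "herm_radical t A = {0}"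
  shows "vec.dim (herm_radical t B) \<le> 1"
proof -
  obtain w where w: "A = {x. \<exists>c. x - c *s w \<in> B}"
    using subspace_extend_by_line[OF B A \<open>B \<subseteq> A\<close> dim] .
  let ?R = "herm_radical t B"
  have R: "vec.subspace ?R" using B by (rule subspace_herm_radical)
  have "inj_on (\<lambda>z. h z w) ?R"
  proof (rule inj_onI)
    fix y z assume y: "y \<in> ?R" and z: "z \<in> ?R" and eq: "h y w = h z w"
    have yz: "y - z \<in> ?R" using R y z by (rule vec.subspace_diff)
    have "h (y - z) x = 0" if "x \<in> A" for x
    proof -
      obtain c where c: "x - c *s w \<in> B" using \<open>x \<in> A\<close> unfolding w by blast
      then have "h (y - z) (x - c *s w) = 0" using yz by (simp add: herm_radical_def)
      moreover have "h (y - z) w = 0" using eq by (simp add: h_diff_left)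
      ultimately have "h (y - z) ((x - c *s w) + c *s w) = 0"
        unfolding h_add_right h_scale_right by simp
      then show ?thesis by simp
    qed
    moreover have "y - z \<in> A" using yz \<open>B \<subseteq> A\<close> by (auto simp: herm_radical_def)
    ultimately have "y - z \<in> herm_radical t A" by (simp add: herm_radical_def)
    then show "y = z" using rad by simp
  qed
  then have "card ?R \<le> CARD('a)"
    by (intro card_inj_on_le[of _ _ UNIV]) simp_all
  then have "CARD('a) ^ vec.dim ?R \<le> CARD('a) ^ 1"
    using card_subspace[OF R] by simp
  moreover have "CARD('a) > 1" using one_less_power[of t 2] t_ge_2 by (simp add: card_field)
  ultimately show ?thesis by (simp only: power_increasing_iff)
qed

lemma tangent_at_eq: "tangent_at t p = {x. h x p = 0}"
  by (simp add: tangent_at_def herm_form_def mult.commute)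

lemma card_tangent_at:
  fixes p :: "'a ^ 5"
  assumes "p \<noteq> 0"
  shows "card (tangent_at t p) = CARD('a) ^ 4"
proof -
  obtain y where "h y p \<noteq> 0"
    using h_nondegenerate[of p] h_eq_0_swap[of p] assms by blast
  then have "hyperplane (tangent_at t p)"
    unfolding tangent_at_eq by (intro hyperplane_kernel) (simp_all add: h_add_left h_scale_left)
  then show ?thesis
    using card_subspace[of "tangent_at t p"] by (simp add: hyperplane_def)
qed

text \<open>The point of tangency lies in the radical. Conversely a nonzero radical vector
  \<open>p\<close> is isotropic and \<open>U\<close> lies in its orthogonal hyperplane; equal
  cardinalities make the two hyperplanes agree.\<close>

lemma tangent_hyperplane_iff:
  fixes U :: "('a ^ 5) set"
  assumes U: "hyperplane U"
  shows "tangent_hyperplane t U \<longleftrightarrow> herm_radical t U \<noteq> {0}"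
proof
  assume "tangent_hyperplane t U"
  then obtain P p where P: "P \<in> herm_variety t" and p: "p \<in> P" "p \<noteq> 0" and eq: "U = tangent_at t p"
    by (auto simp: tangent_hyperplane_def)
  have "H p = 0"
    using P p unfolding H_def by (simp add: herm_variety_def)
  then have "h p p = 0" by (simp add: H_eq)
  then have "p \<in> U" by (simp add: eq tangent_at_eq)
  moreover have "h p x = 0" if "x \<in> U" for x
    using that h_eq_0_swap[of p x] by (simp add: eq tangent_at_eq)
  ultimately have "p \<in> herm_radical t U" by (simp add: herm_radical_def)
  then show "herm_radical t U \<noteq> {0}" using p by blast
next
  have sub: "vec.subspace U" and dim: "vec.dim U = 4" using U by (simp_all add: hyperplane_def)
  have "0 \<in> herm_radical t U"
    using subspace_herm_radical[OF sub] by (rule vec.subspace_0)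
  moreover assume "herm_radical t U \<noteq> {0}"
  ultimately obtain p where p: "p \<in> herm_radical t U" "p \<noteq> 0" by blast
  have "U \<subseteq> tangent_at t p"
    using p h_eq_0_swap[of p] by (auto simp: herm_radical_def tangent_at_eq)
  moreover have "card U = card (tangent_at t p)"
    using card_tangent_at[OF p(2)] card_subspace[OF sub] dim by simp
  ultimately have eq: "U = tangent_at t p" by (intro card_subset_eq) simp_all
  have "H p = 0" using p by (simp add: herm_radical_def H_eq)
  then have "H x = 0" if "x \<in> vec.span {p}" for x
    using that by (auto simp: vec.span_singleton H_scale)
  moreover have "vec.span {p} \<in> points" using p by (simp add: points_def vec.subspace_span)
  ultimately have "vec.span {p} \<in> herm_variety t" unfolding herm_variety_def H_def by blast
  moreover have "p \<in> vec.span {p} - {0}" using p by (simp add: vec.span_base)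
  ultimately show "tangent_hyperplane t U"
    using eq unfolding tangent_hyperplane_def by blast
qed

lemma dim_herm_radical_eq_0_iff:
  fixes W :: "('a ^ 5) set"
  assumes "vec.subspace W"
  shows "vec.dim (herm_radical t W) = 0 \<longleftrightarrow> herm_radical t W = {0}"
  using vec.subspace_0[OF subspace_herm_radical[OF assms]] by auto

text \<open>
  This is \<open>(t\<^sup>2 - 1) (2 t\<^sup>5 + t\<^sup>3 + 2 t\<^sup>2 + 1) + 1\<close>: the affine count for an intersection
  with \<open>2 t\<^sup>5 + t\<^sup>3 + 2 t\<^sup>2 + 1\<close> projective points.
\<close>

definition max_count :: int where
  "max_count = 2 * int t ^ 7 - int t ^ 5 + 2 * int t ^ 4 - int t ^ 3 - int t ^ 2"

lemma t_times_max_count: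
  "int t * max_count = 2 * int t ^ 8 - int t ^ 6 + 2 * int t ^ 5 - int t ^ 4 - int t ^ 3"
  by (simp add: max_count_def algebra_simps power_numeral_reduce)

lemma int_powers_growth: "2 * int t ^ n \<le> int t ^ Suc n"
  using t_ge_2 by (simp add: mult_right_mono)

lemma int_cube_ge: "8 \<le> int t ^ 3"
  using power_mono[of 2 "int t" 3] t_ge_2 by simp

text \<open>These turn comparisons of polynomials in \<open>t\<close> into linear arithmetic with
  the powers of \<open>t\<close> as unknowns.\<close>

lemmas growth = int_cube_ge int_powers_growth[of 3, simplified]
  int_powers_growth[of 4, simplified] int_powers_growth[of 5, simplified]
  int_powers_growth[of 6, simplified] int_powers_growth[of 7, simplified]
  int_powers_growth[of 8, simplified] int_powers_growth[of 9, simplified]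

lemma less_max_countI: "int t * n < int t * max_count \<Longrightarrow> n < max_count"
  using t_ge_2 by simp

text \<open>The whole space has zero radical, so the radical of a hyperplane has dimension 0 or 1,
  and tangency decides which. Then \<open>card_isotropic\<close> applies with
  \<open>m = 4\<close>.\<close>

lemma card_isotropic_hyperplane:
  fixes U :: "('a ^ 5) set"
  assumes U: "hyperplane U"
  shows "int t * int (card {x \<in> U. H x = 0}) =
    (if tangent_hyperplane t U then int t ^ 8 - int t ^ 6 + int t ^ 5 else int t ^ 8 + int t ^ 5 - int t ^ 4)"
proof -
  have sub: "vec.subspace U" and dim: "vec.dim U = 4" using U by (simp_all add: hyperplane_def)
  have "herm_radical t (UNIV :: ('a ^ 5) set) = {0}"
    using h_nondegenerate by (auto simp: herm_radical_def)
  then have "vec.dim (herm_radical t U) \<le> 1"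
    using sub dim by (intro dim_radical_hyperplane[of U UNIV]) (simp_all add: vec.subspace_UNIV card_cart_basis)
  then have "vec.dim (herm_radical t U) = (if tangent_hyperplane t U then 1 else 0)"
    unfolding tangent_hyperplane_iff[OF U] dim_herm_radical_eq_0_iff[OF sub, symmetric]
    by (cases "vec.dim (herm_radical t U) = 0"; simp del: vec.dim_eq_0)
  then show ?thesis
    using card_isotropic[OF sub] dim
    by (cases "tangent_hyperplane t U") (simp_all add: algebra_simps power_numeral_reduce del: vec.dim_eq_0)
qed

text \<open>This settles quadrics that are a repeated hyperplane: after multiplication by
  \<open>t\<close> the leading terms are \<open>t ^ 8\<close> against
  \<open>2 * t ^ 8\<close>.\<close>

lemma card_isotropic_one_hyperplane:
  fixes U :: "('a ^ 5) set"
  assumes "hyperplane U"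
  shows "int (card {x \<in> U. H x = 0}) < max_count"
proof (rule less_max_countI)
  show "int t * int (card {x \<in> U. H x = 0}) < int t * max_count"
    unfolding t_times_max_count card_isotropic_hyperplane[OF assms] using growth by simp
qed

text \<open>The strict inequality will show that an optimal quadric cannot contain the whole
  variety, so that its codeword is nonzero.\<close>

lemma card_isotropic_UNIV: "max_count < int (card {x. H x = 0})"
proof -
  have "herm_radical t (UNIV :: ('a ^ 5) set) = {0}"
    using h_nondegenerate by (auto simp: herm_radical_def)
  then have "int t * int (card {x. H x = 0}) = int t ^ 10 - int t ^ 6 + int t ^ 5"
    using card_isotropic[OF vec.subspace_UNIV]
    by (simp add: card_cart_basis algebra_simps power_numeral_reduce)
  then have "int t * max_count < int t * int (card {x. H x = 0})"
    using growth by (simp add: t_times_max_count)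
  then show ?thesis using t_ge_2 by simp
qed

lemma dim_hyperplanes_Int:
  fixes U V :: "('a ^ 5) set"
  assumes U: "hyperplane U" and V: "hyperplane V" and "U \<noteq> V"
  shows "vec.subspace (U \<inter> V)" "vec.dim (U \<inter> V) = 3"
proof -
  have sub: "vec.subspace U" "vec.subspace V" and dim: "vec.dim U = 4" "vec.dim V = 4"
    using U V by (simp_all add: hyperplane_def)
  then show W: "vec.subspace (U \<inter> V)" by (intro vec.subspace_inter)
  have "vec.dim {x + y |x y. x \<in> U \<and> y \<in> V} \<le> 5"
    using vec.dim_subset[OF subset_UNIV, of "{x + y |x y. x \<in> U \<and> y \<in> V}"] by (simp add: card_cart_basis)
  then have "vec.dim (U \<inter> V) \<ge> 3"
    using vec.dim_sums_Int[OF sub] dim by simp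
  moreover have "vec.dim (U \<inter> V) \<noteq> 4"
  proof
    assume "vec.dim (U \<inter> V) = 4"
    then have "U \<inter> V = U" "U \<inter> V = V"
      using vec.subspace_dim_equal[OF W] sub dim by simp_all
    with \<open>U \<noteq> V\<close> show False by simp
  qed
  moreover have "vec.dim (U \<inter> V) \<le> 4"
    using vec.dim_subset[of "U \<inter> V" U] dim by simp
  ultimately show "vec.dim (U \<inter> V) = 3" by simp
qed

text \<open>Inclusion and exclusion reduce the claim to finitely many polynomials in
  \<open>t\<close>, indexed by the tangency of each hyperplane and the dimension \<open>?s\<close>
  of the radical on their common plane.\<close>

lemma card_isotropic_two_hyperplanes:
  fixes U V :: "('a ^ 5) set"
  assumes U: "hyperplane U" and V: "hyperplane V" and "U \<noteq> V"
  defines "N \<equiv> int (card {x. H x = 0 \<and> x \<in> U \<union> V})"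
    and "good \<equiv> \<not> tangent_hyperplane t U \<and> \<not> tangent_hyperplane t V \<and> nonsingular_plane_section t (U \<inter> V)"
  shows "good \<Longrightarrow> N = max_count" and "\<not> good \<Longrightarrow> N < max_count"
proof -
  let ?W = "U \<inter> V"
  let ?s = "vec.dim (herm_radical t ?W)"
  let ?Z = "\<lambda>S. int t * int (card {x \<in> S. H x = 0})"
  note W = dim_hyperplanes_Int[OF U V \<open>U \<noteq> V\<close>]
  have N: "int t * N = ?Z U + ?Z V - ?Z ?W"
  proof -
    have "{x. H x = 0 \<and> x \<in> U \<union> V} = {x \<in> U. H x = 0} \<union> {x \<in> V. H x = 0}"
      "{x \<in> ?W. H x = 0} = {x \<in> U. H x = 0} \<inter> {x \<in> V. H x = 0}"
      by auto
    then have "card {x \<in> U. H x = 0} + card {x \<in> V. H x = 0}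
        = card {x. H x = 0 \<and> x \<in> U \<union> V} + card {x \<in> ?W. H x = 0}"
      by (simp only:) (rule card_Un_Int; rule finite)
    then have "N = int (card {x \<in> U. H x = 0}) + int (card {x \<in> V. H x = 0}) - int (card {x \<in> ?W. H x = 0})"
      unfolding N_def by linarith
    then show ?thesis by (simp only: right_diff_distrib distrib_left)
  qed
  have ZW: "?Z ?W = int t ^ 6 + (- 1) ^ (3 + ?s) * (int t - 1) * int t ^ (3 + ?s)"
    using card_isotropic[OF W(1)] by (simp add: W(2))
  have s_le: "?s \<le> 3"
    using vec.dim_subset[of "herm_radical t ?W" ?W] W(2) by (auto simp: herm_radical_def)
  have good: "good \<longleftrightarrow> \<not> tangent_hyperplane t U \<and> \<not> tangent_hyperplane t V \<and> ?s = 0"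
    using W s_le by (auto simp: good_def nonsingular_plane_section_def herm_rank_def simp del: vec.dim_eq_0)
  note counts = N card_isotropic_hyperplane[OF U] card_isotropic_hyperplane[OF V] ZW
  show "N = max_count" if good
  proof -
    from that have s: "?s = 0" and nt: "\<not> tangent_hyperplane t U" "\<not> tangent_hyperplane t V"
      unfolding good by blast+
    have "int t * N = int t * max_count"
      unfolding t_times_max_count counts s
      by (simp add: nt algebra_simps power_numeral_reduce)
    then show ?thesis using t_ge_2 by simp
  qed
  show "N < max_count" if "\<not> good"
  proof (rule less_max_countI, cases "tangent_hyperplane t U \<or> tangent_hyperplane t V")
    case False
    \<comment> \<open>The plane has codimension 1 in \<open>U\<close>, where the form is
      nondegenerate. The remaining value \<open>?s = 1\<close> gives a larger plane section than
      \<open>?s = 0\<close>, so more is subtracted.\<close>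
    have "?s \<le> 1"
    proof (rule dim_radical_hyperplane)
      show "vec.subspace U" "vec.dim U = Suc (vec.dim ?W)" using U W(2) by (simp_all add: hyperplane_def)
      show "herm_radical t U = {0}" using False tangent_hyperplane_iff[OF U] by simp
    qed (use W(1) in simp_all)
    then have "?s = 1" using False that good by linarith
    then have "?Z ?W = int t ^ 6 + int t ^ 5 - int t ^ 4"
      unfolding ZW by (simp add: algebra_simps power_numeral_reduce)
    then show "int t * N < int t * max_count"
      using False N growth card_isotropic_hyperplane[OF U] card_isotropic_hyperplane[OF V]
      by (simp add: t_times_max_count)
  next
    case True
    have ZW_values: "?s = 0 \<Longrightarrow> ?Z ?W = int t ^ 6 - int t ^ 4 + int t ^ 3"
      "?s = 1 \<Longrightarrow> ?Z ?W = int t ^ 6 + int t ^ 5 - int t ^ 4"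
      "?s = 2 \<Longrightarrow> ?Z ?W = int t ^ 5" "?s = 3 \<Longrightarrow> ?Z ?W = int t ^ 7"
      unfolding ZW
      by (simp_all add: algebra_simps power_numeral_reduce del: vec.dim_eq_0)
    have "?s = 0 \<or> ?s = 1 \<or> ?s = 2 \<or> ?s = 3" using s_le by linarith
    \<comment> \<open>The smallest plane section is the one with \<open>?s = 2\<close>. Even
      subtracting only that much, the loss caused by one tangent hyperplane is decisive.\<close>
    then have "?Z ?W \<ge> int t ^ 5"
      using growth ZW_values by linarith
    then show "int t * N < int t * max_count"
      using True N growth card_isotropic_hyperplane[OF U] card_isotropic_hyperplane[OF V]
      by (auto simp: t_times_max_count split: if_splits)
  qed
qed

end

section \<open>Zeros of quadratic forms\<close>

definition polar_form :: "'a::field poly5 \<Rightarrow> 'a ^ 5 \<Rightarrow> 'a ^ 5 \<Rightarrow> 'a" where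
  "polar_form f x y = eval_poly f (x + y) - eval_poly f x - eval_poly f y"

lemma eval_poly_add: "eval_poly f (x + y) = eval_poly f x + eval_poly f y + polar_form f x y"
  by (simp add: polar_form_def)

lemma polar_form_sym: "polar_form f x y = polar_form f y x"
  by (simp add: polar_form_def add.commute)

text \<open>Lowering a positive exponent by one leaves degree 1, that is, a single variable. The
  indices \<open>i\<close> and \<open>j\<close> may coincide.\<close>

lemma monomial_degree_2:
  fixes m :: "5 \<Rightarrow> nat"
  assumes "(\<Sum>i\<in>UNIV. m i) = 2"
  obtains i j where "\<And>x :: 'a::field ^ 5. (\<Prod>k\<in>UNIV. (x $ k) ^ m k) = x $ i * x $ j"
proof -
  have "(\<Sum>i\<in>UNIV. m i) \<noteq> 0" using assms by simp
  then obtain i where i: "m i > 0" by auto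
  define g where "g = m(i := m i - 1)"
  have g: "m i = Suc (g i)" "\<And>k. k \<noteq> i \<Longrightarrow> m k = g k" using i by (auto simp: g_def)
  have "(\<Sum>k\<in>UNIV. m k) = Suc (g i + (\<Sum>k\<in>UNIV - {i}. g k))"
    by (subst sum.remove[of UNIV i]) (auto simp: g intro!: sum.cong)
  then have "(\<Sum>k\<in>UNIV. g k) = Suc 0"
    using assms sum.remove[of UNIV i g] by simp
  then obtain j where j: "g j = Suc 0" "\<And>k. j \<noteq> k \<Longrightarrow> g k = 0"
    unfolding sum_eq_Suc0_iff[OF finite] by blast
  have "(\<Prod>k\<in>UNIV. (x $ k) ^ m k) = x $ i * x $ j" for x :: "'a ^ 5"
  proof -
    have "(\<Prod>k\<in>UNIV. (x $ k) ^ m k) = (x $ i) ^ m i * (\<Prod>k\<in>UNIV - {i}. (x $ k) ^ m k)"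
      by (rule prod.remove) auto
    also have "(\<Prod>k\<in>UNIV - {i}. (x $ k) ^ m k) = (\<Prod>k\<in>UNIV - {i}. (x $ k) ^ g k)"
      using g(2) by (intro prod.cong) auto
    also have "(x $ i) ^ m i * \<dots> = x $ i * (\<Prod>k\<in>UNIV. (x $ k) ^ g k)"
      using prod.remove[of UNIV i "\<lambda>k. (x $ k) ^ g k"] by (simp add: g(1) mult.assoc)
    also have "(\<Prod>k\<in>UNIV. (x $ k) ^ g k) = (x $ j) ^ g j * (\<Prod>k\<in>UNIV - {j}. (x $ k) ^ g k)"
      by (rule prod.remove) auto
    also have "(\<Prod>k\<in>UNIV - {j}. (x $ k) ^ g k) = 1"
      using j(2) by (intro prod.neutral) auto
    finally show ?thesis using j(1) by simp
  qed
  then show ?thesis using that by blast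
qed

text \<open>Polarising a product of two coordinates gives
  \<open>x $ i * y $ j + y $ i * x $ j\<close>, in every characteristic; the general case is a
  linear combination of these.\<close>

lemma polar_form_bilinear:
  assumes "f \<in> quadratic_forms"
  shows polar_form_add_left: "polar_form f (x + y) z = polar_form f x z + polar_form f y z"
    and polar_form_scale_left: "polar_form f (c *s x) z = c * polar_form f x z"
proof -
  have "\<exists>i j. \<forall>x :: 'a ^ 5. (\<Prod>k\<in>UNIV. (x $ k) ^ Poly_Mapping.lookup m k) = x $ i * x $ j"
    if "m \<in> Poly_Mapping.keys f" for m
  proof -
    have "(\<Sum>i\<in>UNIV. Poly_Mapping.lookup m i) = 2"
      using assms that by (simp add: quadratic_forms_def)
    then show ?thesis by (elim monomial_degree_2) blast
  qed
  then obtain i j where ij: "\<And>m x. m \<in> Poly_Mapping.keys f \<Longrightarrow>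
      (\<Prod>k\<in>UNIV. (x $ k :: 'a) ^ Poly_Mapping.lookup m k) = x $ i m * x $ j m"
    by metis
  have "eval_poly f x = (\<Sum>m\<in>Poly_Mapping.keys f. Poly_Mapping.lookup f m * (x $ i m * x $ j m))" for x
    unfolding eval_poly_def by (intro sum.cong) (simp_all add: ij)
  then have polar: "polar_form f x y = (\<Sum>m\<in>Poly_Mapping.keys f.
      Poly_Mapping.lookup f m * (x $ i m * y $ j m + y $ i m * x $ j m))" for x y
    by (simp add: polar_form_def algebra_simps sum.distrib)
  show "polar_form f (x + y) z = polar_form f x z + polar_form f y z"
    "polar_form f (c *s x) z = c * polar_form f x z"
    by (simp_all add: polar algebra_simps sum.distrib sum_distrib_left)
qed

lemma polar_form_add_right:
  "f \<in> quadratic_forms \<Longrightarrow> polar_form f z (x + y) = polar_form f z x + polar_form f z y"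
  and polar_form_scale_right:
  "f \<in> quadratic_forms \<Longrightarrow> polar_form f z (c *s x) = c * polar_form f z x"
  by (simp_all only: polar_form_sym[of f z] polar_form_bilinear)

lemma polar_form_self: "f \<in> quadratic_forms \<Longrightarrow> polar_form f x x = 2 * eval_poly f x"
proof -
  assume f: "f \<in> quadratic_forms"
  have "x + x = 2 *s x" by (simp add: vec_eq_iff)
  then show ?thesis using eval_poly_scale[OF f, of 2 x] by (simp add: polar_form_def)
qed

text \<open>
  For a zero \<open>v\<close> of the form, every line through \<open>v\<close> off the hyperplane orthogonal to \<open>v\<close> contains
  exactly one further zero, so the number of zeros is governed by the zeros in that hyperplane.
\<close>

lemma card_quadric_outside_tangent:
  fixes f :: "'a::{field,finite} poly5"
  assumes f: "f \<in> quadratic_forms" and v: "eval_poly f v = 0"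
  shows "CARD('a) * card {x. polar_form f v x \<noteq> 0 \<and> eval_poly f x = 0} \<le> card {x. polar_form f v x \<noteq> 0}"
proof -
  let ?A = "{x. polar_form f v x \<noteq> 0 \<and> eval_poly f x = 0}"
  have vv: "polar_form f v v = 0" using polar_form_self[OF f, of v] v by simp
  have val: "polar_form f v (x + c *s v) = polar_form f v x"
    "eval_poly f (x + c *s v) = eval_poly f x + c * polar_form f v x" for x c
    by (simp_all add: polar_form_add_right[OF f] polar_form_scale_right[OF f] vv
        eval_poly_add eval_poly_scale[OF f] v polar_form_sym[of f x v])
  have "card ((UNIV :: 'a set) \<times> ?A) \<le> card {x. polar_form f v x \<noteq> 0}"
  proof (rule card_inj_on_le)
    show "(\<lambda>(c, x). x + c *s v) ` (UNIV \<times> ?A) \<subseteq> {x. polar_form f v x \<noteq> 0}"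
      by (auto simp: val)
    \<comment> \<open>At \<open>x + c *s v\<close> the polar functional is still that of
      \<open>x\<close>, and the form takes the value \<open>c * polar_form f v x\<close>. The two
      together determine \<open>c\<close>, and then \<open>x\<close>.\<close>
    have inj: "c = d \<and> x = y" if xy: "x \<in> ?A" "y \<in> ?A" and eq: "x + c *s v = y + d *s v" for c d x y
    proof -
      have "polar_form f v x = polar_form f v y" "c * polar_form f v x = d * polar_form f v y"
        using arg_cong[OF eq, of "polar_form f v"] arg_cong[OF eq, of "eval_poly f"] xy
        by (simp_all add: val)
      then have "c = d" using xy by simp
      then show ?thesis using eq by simp
    qed
    show "inj_on (\<lambda>(c, x). x + c *s v) (UNIV \<times> ?A)"
    proof (rule inj_onI)
      show "p = r" if "p \<in> UNIV \<times> ?A" "r \<in> UNIV \<times> ?A"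
        "(case p of (c, x) \<Rightarrow> x + c *s v) = (case r of (c, x) \<Rightarrow> x + c *s v)" for p r
        using that inj[of "snd p" "snd r" "fst p" "fst r"]
        by (simp only: mem_Times_iff case_prod_unfold prod_eq_iff)
    qed
  qed simp
  then show ?thesis by (simp add: card_cartesian_product)
qed

text \<open>Restricted to a line in direction \<open>w\<close>, the form is a quadratic polynomial
  with leading coefficient \<open>eval_poly f w\<close>, so it has at most two zeros there. Summing
  over all starting points \<open>y\<close> in \<open>U\<close> gives the bound.\<close>

lemma card_quadric_in_subspace:
  fixes f :: "'a::{field,finite} poly5"
  assumes f: "f \<in> quadratic_forms" and U: "vec.subspace U" and w: "w \<in> U" "eval_poly f w \<noteq> 0"
  shows "CARD('a) * card {x \<in> U. eval_poly f x = 0} \<le> 2 * card U"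
proof -
  have shift: "card {y \<in> U. eval_poly f (y + c *s w) = 0} = card {x \<in> U. eval_poly f x = 0}" for c
  proof (rule bij_betw_same_card, rule bij_betwI)
    have cw: "c *s w \<in> U" using U w(1) by (rule vec.subspace_scale)
    show "(\<lambda>y. y + c *s w) \<in> {y \<in> U. eval_poly f (y + c *s w) = 0} \<rightarrow> {x \<in> U. eval_poly f x = 0}"
      using vec.subspace_add[OF U _ cw] by simp
    show "(\<lambda>x. x - c *s w) \<in> {x \<in> U. eval_poly f x = 0} \<rightarrow> {y \<in> U. eval_poly f (y + c *s w) = 0}"
      using vec.subspace_diff[OF U _ cw] by simp
  qed simp_all
  have "CARD('a) * card {x \<in> U. eval_poly f x = 0}
      = (\<Sum>c\<in>(UNIV :: 'a set). card {y \<in> U. eval_poly f (y + c *s w) = 0})"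
    by (simp add: shift)
  also have "\<dots> = (\<Sum>c\<in>(UNIV :: 'a set). \<Sum>y\<in>U. if eval_poly f (y + c *s w) = 0 then 1 else 0)"
    by (simp add: sum.If_cases Int_def)
  also have "\<dots> = (\<Sum>y\<in>U. \<Sum>c\<in>(UNIV :: 'a set). if eval_poly f (y + c *s w) = 0 then 1 else 0)"
    by (rule sum.swap)
  also have "\<dots> = (\<Sum>y\<in>U. card {c. eval_poly f (y + c *s w) = 0})"
    by (simp add: sum.If_cases)
  also have "\<dots> \<le> (\<Sum>y\<in>U. 2)"
  proof (rule sum_mono)
    fix y
    have "eval_poly f (y + c *s w) = eval_poly f w *
        (c ^ 2 + polar_form f y w / eval_poly f w * c + eval_poly f y / eval_poly f w)" for c
      using w(2) by (simp add: eval_poly_add eval_poly_scale[OF f] polar_form_scale_right[OF f] field_simps)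
    then have "{c. eval_poly f (y + c *s w) = 0} =
        {c. c ^ 2 + polar_form f y w / eval_poly f w * c + eval_poly f y / eval_poly f w = 0}"
      using w(2) by simp
    then show "card {c. eval_poly f (y + c *s w) = 0} \<le> 2"
      using card_power_eq_le[of 2 "polar_form f y w / eval_poly f w" "eval_poly f y / eval_poly f w"]
      by simp
  qed
  finally show ?thesis by (simp add: mult.commute)
qed

text \<open>If every zero is singular, then \<open>f\<close> takes the value
  \<open>c ^ 2 * eval_poly f w\<close> at \<open>x + c *s w\<close> for each zero \<open>x\<close>.
  Hence the translates of the zero set by multiples of \<open>w\<close> are disjoint.\<close>

lemma card_quadric_all_singular:
  fixes f :: "'a::{field,finite} poly5"
  assumes f: "f \<in> quadratic_forms" and w: "eval_poly f w \<noteq> 0"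
    and sing: "\<And>v x. eval_poly f v = 0 \<Longrightarrow> polar_form f v x = 0"
  shows "card {x. eval_poly f x = 0} \<le> CARD('a) ^ 4"
proof -
  let ?A = "{x. eval_poly f x = 0}"
  have val: "eval_poly f (x + c *s w) = c ^ 2 * eval_poly f w" "polar_form f y (x + c *s w) = 0"
    if "x \<in> ?A" "y \<in> ?A" for x y c
    using that by (simp_all add: eval_poly_add eval_poly_scale[OF f] sing)
  have "card ((UNIV :: 'a set) \<times> ?A) \<le> card (UNIV :: ('a ^ 5) set)"
  proof (rule card_inj_on_le)
    have inj: "c = d \<and> x = y" if xy: "x \<in> ?A" "y \<in> ?A" and eq: "x + c *s w = y + d *s w" for c d x y
    proof -
      have "y = x + (c - d) *s w" using eq by (simp add: vector_sub_rdistrib algebra_simps)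
      then have "(c - d) ^ 2 * eval_poly f w = 0" using val(1)[OF xy, of "c - d"] xy by simp
      then have "c = d" using w by simp
      then show ?thesis using eq by simp
    qed
    show "inj_on (\<lambda>(c, x). x + c *s w) (UNIV \<times> ?A)"
    proof (rule inj_onI)
      show "p = r" if "p \<in> UNIV \<times> ?A" "r \<in> UNIV \<times> ?A"
        "(case p of (c, x) \<Rightarrow> x + c *s w) = (case r of (c, x) \<Rightarrow> x + c *s w)" for p r
        using that inj[of "snd p" "snd r" "fst p" "fst r"]
        by (simp only: mem_Times_iff case_prod_unfold prod_eq_iff)
    qed
  qed simp_all
  then have "CARD('a) * card ?A \<le> CARD('a) * CARD('a) ^ 4"
    by (simp add: card_cartesian_product power_numeral_reduce)
  then show ?thesis by simp
qed

text \<open>Take a nonsingular zero \<open>v\<close>. If the form vanishes on the tangent hyperplane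
  at \<open>v\<close>, the equation of that hyperplane splits off as a factor; otherwise the zeros
  inside and outside it are both few. The hyperplanes \<open>U\<close> and \<open>V\<close> may be
  equal.\<close>

lemma quadric_dichotomy:
  fixes f :: "'a::{field,finite} poly5"
  assumes f: "f \<in> quadratic_forms" and nz: "eval_poly f w0 \<noteq> 0"
  obtains (small) "card {x. eval_poly f x = 0} \<le> CARD('a) ^ 4 + CARD('a) ^ 3"
  | (split) U V where "hyperplane U" "hyperplane V" "{x. eval_poly f x = 0} = U \<union> V"
proof -
  let ?Q = "eval_poly f" and ?q = "CARD('a)"
  have q: "?q > 0" by simp
  show ?thesis
  proof (cases "\<exists>v w. ?Q v = 0 \<and> polar_form f v w \<noteq> 0")
    case False
    then have "card {x. ?Q x = 0} \<le> ?q ^ 4"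
      using card_quadric_all_singular[OF f nz] by blast
    then show ?thesis using small by linarith
  next
    case True
    then obtain v w' where v: "?Q v = 0" and w': "polar_form f v w' \<noteq> 0" by blast
    let ?U = "{x. polar_form f v x = 0}"
    have U: "hyperplane ?U"
      using w' by (intro hyperplane_kernel)
        (simp_all add: polar_form_add_right[OF f] polar_form_scale_right[OF f])
    then have card_U: "card ?U = ?q ^ 4" and sub: "vec.subspace ?U"
      using card_subspace[of ?U] by (simp_all add: hyperplane_def)
    show ?thesis
    proof (cases "\<exists>u\<in>?U. ?Q u \<noteq> 0")
      case True
      then obtain u where "u \<in> ?U" "?Q u \<noteq> 0" by blast
      from card_quadric_in_subspace[OF f sub this]
      have 1: "?q * card {x \<in> ?U. ?Q x = 0} \<le> 2 * ?q ^ 4" by (simp only: card_U)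
      have "{x. polar_form f v x \<noteq> 0} = UNIV - ?U" by blast
      then have "card {x. polar_form f v x \<noteq> 0} = ?q ^ 5 - ?q ^ 4"
        using card_Diff_subset[of ?U UNIV] card_U by simp
      then have 2: "?q * card {x. polar_form f v x \<noteq> 0 \<and> ?Q x = 0} \<le> ?q ^ 5 - ?q ^ 4"
        using card_quadric_outside_tangent[OF f v] by simp
      have "?q ^ 4 \<le> ?q ^ 5" using q by (intro power_increasing) simp_all
      have "{x. ?Q x = 0} = {x \<in> ?U. ?Q x = 0} \<union> {x. polar_form f v x \<noteq> 0 \<and> ?Q x = 0}" by blast
      then have "card {x. ?Q x = 0} \<le> card {x \<in> ?U. ?Q x = 0} + card {x. polar_form f v x \<noteq> 0 \<and> ?Q x = 0}"
        by (simp only: card_Un_le)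
      then have "?q * card {x. ?Q x = 0} \<le> ?q * (card {x \<in> ?U. ?Q x = 0} + card {x. polar_form f v x \<noteq> 0 \<and> ?Q x = 0})"
        by (rule mult_le_mono2)
      also have "\<dots> \<le> ?q ^ 5 + ?q ^ 4"
        using 1 2 \<open>?q ^ 4 \<le> ?q ^ 5\<close> unfolding distrib_left by linarith
      also have "\<dots> = ?q * (?q ^ 4 + ?q ^ 3)" by (simp add: algebra_simps power_numeral_reduce)
      finally have "card {x. ?Q x = 0} \<le> ?q ^ 4 + ?q ^ 3" using q by (simp only: mult_le_cancel1)
      then show ?thesis by (rule small)
    next
      case False
      \<comment> \<open>With \<open>polar_form f v w = 1\<close>, subtracting
        \<open>polar_form f v x *s w\<close> moves any \<open>x\<close> into \<open>?U\<close>,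
        where the form vanishes. Expanding around that vector exhibits the cofactor
        \<open>m\<close>.\<close>
      define w where "w = inverse (polar_form f v w') *s w'"
      have w: "polar_form f v w = 1" using w' by (simp add: w_def polar_form_scale_right[OF f])
      define m where "m x = polar_form f x w - polar_form f v x * ?Q w" for x
      have eq: "?Q x = polar_form f v x * m x" for x
      proof -
        let ?l = "polar_form f v x"
        define u where "u = x + (- ?l) *s w"
        have "polar_form f v u = 0"
          by (simp only: u_def polar_form_add_right[OF f] polar_form_scale_right[OF f] w) simp
        then have Qu: "?Q u = 0" using False by blast
        have uw: "polar_form f u w = polar_form f x w - ?l * (2 * ?Q w)"
          by (simp only: u_def polar_form_add_left[OF f] polar_form_scale_left[OF f] polar_form_self[OF f])
             simp
        have Qx: "?Q (u + ?l *s w) = ?Q u + ?l ^ 2 * ?Q w + ?l * polar_form f u w"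
          by (simp only: eval_poly_add eval_poly_scale[OF f] polar_form_scale_right[OF f])
        have "u + ?l *s w = x" by (simp add: u_def)
        with Qx show ?thesis
          unfolding Qu uw m_def by (simp add: power2_eq_square algebra_simps)
      qed
      have "hyperplane {x. m x = 0}"
      proof (rule hyperplane_kernel)
        show "m (x + y) = m x + m y" "m (c *s x) = c * m x" for x y c
          by (simp_all add: m_def polar_form_add_left[OF f] polar_form_scale_left[OF f]
              polar_form_add_right[OF f] polar_form_scale_right[OF f] algebra_simps)
        show "m w0 \<noteq> 0" using nz eq by auto
      qed
      moreover have "{x. ?Q x = 0} = ?U \<union> {x. m x = 0}" by (auto simp: eq)
      ultimately show ?thesis using split U by blast
    qed
  qed
qed

section \<open>Intersections with quadrics\<close>

context hermitian_field
begin

section \<open>Twisted forms and averaging over the twist\<close>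

definition twisted :: "'a poly5 \<Rightarrow> 'a \<Rightarrow> 'a ^ 5 \<Rightarrow> 'a" where
  "twisted f a x = H x + Tr (a * eval_poly f x)"

text \<open>This is the radical of the polar form of \<open>twisted f a\<close> with the trace
  stripped off.\<close>

definition twisted_radical :: "'a poly5 \<Rightarrow> 'a \<Rightarrow> ('a ^ 5) set" where
  "twisted_radical f a = {z. \<forall>x. h x z + a * polar_form f x z = 0}"

lemma card_space: "card (UNIV :: ('a ^ 5) set) = (t ^ 5) ^ 2"
  by (simp add: card_field flip: power_mult)

text \<open>This is \<open>deviation_bound\<close> on the whole space after taking square roots;
  \<open>t ^ 5\<close> is the square root of the number of vectors.\<close>

lemma card_twisted_zeros:
  assumes f: "f \<in> quadratic_forms"
  shows "real t * real (card {x. twisted f a x = 0}) - real t ^ 10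
    \<le> (real t - 1) * real t ^ 5 * sqrt (real (card (twisted_radical f a)))"
proof -
  let ?\<beta> = "\<lambda>x z. Tr (h x z + a * polar_form f x z)"
  interpret Ft_quadratic_form t ty UNIV "twisted f a" ?\<beta>
  proof unfold_locales
    fix x y z :: "'a ^ 5" and c :: 'a
    show "twisted f a x \<in> Ft" by (simp add: twisted_def H_in_Ft Tr_in_Ft Ft_closed)
    show "twisted f a (x + z) = twisted f a x + twisted f a z + ?\<beta> x z"
      by (simp add: twisted_def H_add eval_poly_add distrib_left Tr_add)
    have "polar_form f (x - y) z = polar_form f x z - polar_form f y z"
      using polar_form_add_left[OF f, of "x - y" y z] by (simp add: eq_diff_eq)
    then have "h (x - y) z + a * polar_form f (x - y) z
        = (h x z + a * polar_form f x z) - (h y z + a * polar_form f y z)"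
      by (simp only: h_diff_left) (simp add: algebra_simps)
    then show "?\<beta> (x - y) z = ?\<beta> x z - ?\<beta> y z" by (simp only: Tr_diff)
    have "h (c *s x) z + a * polar_form f (c *s x) z = c * (h x z + a * polar_form f x z)"
      by (simp add: h_scale_left polar_form_scale_left[OF f] algebra_simps)
    then show "?\<beta> (c *s x) z = c * ?\<beta> x z" if "c \<in> Ft"
      using Tr_mult_Ft[OF that] by simp
  qed (rule vec.subspace_UNIV)
  have "radical \<subseteq> twisted_radical f a"
  proof
    fix z assume z: "z \<in> radical"
    have "h x z + a * polar_form f x z = 0" for x
    proof (rule Tr_nondegenerate)
      show "Tr (c * (h x z + a * polar_form f x z)) = 0" for c
      proof -
        have "?\<beta> (c *s x) z = 0" using z by (simp add: radical_def)
        then show ?thesis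
          by (simp add: h_scale_left polar_form_scale_left[OF f] algebra_simps)
      qed
    qed
    then show "z \<in> twisted_radical f a" by (simp add: twisted_radical_def)
  qed
  then have k: "card radical \<le> card (twisted_radical f a)" by (intro card_mono) simp_all
  have card_V: "card (UNIV :: ('a ^ 5) set) = t ^ 10"
    by (simp add: card_field flip: power_mult)
  have "(deviation 0)\<^sup>2 \<le> (real t - 1)\<^sup>2 * (real t ^ 10 * real (card radical))"
    using deviation_bound unfolding card_V by simp
  also have "\<dots> \<le> (real t - 1)\<^sup>2 * (real t ^ 10 * real (card (twisted_radical f a)))"
    using k by (intro mult_left_mono) simp_all
  also have "\<dots> = ((real t - 1) * real t ^ 5 * sqrt (real (card (twisted_radical f a))))\<^sup>2"
    by (simp add: power_mult_distrib flip: power_mult)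
  finally have "deviation 0 \<le> (real t - 1) * real t ^ 5 * sqrt (real (card (twisted_radical f a)))"
    using t_ge_2 by (intro power2_le_imp_le[of "deviation 0"]) simp_all
  then show ?thesis unfolding deviation_def card_V by simp
qed

lemma twisted_radical_0: "twisted_radical f 0 = {0}"
proof -
  have "z = 0" if "\<And>x. h x z = 0" for z
    using that h_nondegenerate[of z] h_eq_0_swap[of z] by blast
  moreover have "h x 0 = 0" for x using h_eq_0_swap[of x 0] by simp
  ultimately show ?thesis by (auto simp: twisted_radical_def)
qed

text \<open>Double counting of pairs \<open>a\<close>, \<open>x\<close>. If \<open>f\<close>
  vanishes at \<open>x\<close>, the twist has no effect, so all \<open>t ^ 2\<close> scalars or none
  qualify. Otherwise \<open>a * eval_poly f x\<close> runs through the field, and its trace takes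
  the value \<open>- H x\<close> exactly \<open>t\<close> times.\<close>

lemma sum_twisted_zeros:
  "t\<^sup>2 * card {x. H x = 0 \<and> eval_poly f x = 0} + t ^ 11
     = (\<Sum>a\<in>UNIV. card {x. twisted f a x = 0}) + t * card {x. eval_poly f x = 0}"
proof -
  let ?Q = "eval_poly f"
  have fibre: "card {a. twisted f a x = 0} =
      (if ?Q x = 0 then if H x = 0 then t\<^sup>2 else 0 else t)" for x
  proof (cases "?Q x = 0")
    case True
    then show ?thesis by (simp add: twisted_def card_field)
  next
    case False
    have "card {a. twisted f a x = 0} = card {b. Tr b = - H x}"
    proof (rule bij_betw_same_card, rule bij_betwI)
      show "(\<lambda>a. a * ?Q x) \<in> {a. twisted f a x = 0} \<rightarrow> {b. Tr b = - H x}"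
        by (simp add: twisted_def eq_neg_iff_add_eq_0 add.commute)
      show "(\<lambda>b. b / ?Q x) \<in> {b. Tr b = - H x} \<rightarrow> {a. twisted f a x = 0}"
        using False by (simp add: twisted_def)
    qed (use False in simp_all)
    then show ?thesis using False card_Tr_fibre H_in_Ft Ft_closed(6) by simp
  qed
  have "(\<Sum>a\<in>UNIV. card {x. twisted f a x = 0})
      = (\<Sum>a\<in>UNIV. \<Sum>x\<in>UNIV. if twisted f a x = 0 then 1 else 0)"
    by (simp add: sum.If_cases)
  also have "\<dots> = (\<Sum>x\<in>UNIV. \<Sum>a\<in>UNIV. if twisted f a x = 0 then 1 else 0)"
    by (rule sum.swap)
  also have "\<dots> = (\<Sum>x\<in>UNIV. card {a. twisted f a x = 0})"
    by (simp add: sum.If_cases)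
  also have "\<dots> = (\<Sum>x\<in>UNIV. if ?Q x = 0 then if H x = 0 then t\<^sup>2 else 0 else t)"
    by (simp only: fibre)
  also have "\<dots> = (\<Sum>x | ?Q x = 0. if H x = 0 then t\<^sup>2 else 0) + t * card {x. ?Q x \<noteq> 0}"
    by (simp add: sum.If_cases Collect_neg_eq)
  also have "(\<Sum>x | ?Q x = 0. if H x = 0 then t\<^sup>2 else 0) = t\<^sup>2 * card {x. H x = 0 \<and> ?Q x = 0}"
    by (simp add: sum.If_cases Int_def conj_commute)
  also have "card {x. ?Q x \<noteq> 0} = t ^ 10 - card {x. ?Q x = 0}"
  proof -
    have "{x. ?Q x \<noteq> 0} = UNIV - {x. ?Q x = 0}" by blast
    then show ?thesis
      by (simp only: card_Diff_subset[OF finite subset_UNIV] card_space)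
         (simp flip: power_mult)
  qed
  finally have 1: "(\<Sum>a\<in>UNIV. card {x. twisted f a x = 0})
      = t\<^sup>2 * card {x. H x = 0 \<and> ?Q x = 0} + t * (t ^ 10 - card {x. ?Q x = 0})" .
  have "card {x. ?Q x = 0} \<le> t ^ 10"
    using card_mono[of UNIV "{x. ?Q x = 0}"] by (simp add: card_field flip: power_mult)
  then have "t * (t ^ 10 - card {x. ?Q x = 0}) + t * card {x. ?Q x = 0} = t ^ 11"
    by (simp add: power_numeral_reduce flip: distrib_left)
  then show ?thesis unfolding 1 by simp
qed

section \<open>Radicals of the twisted forms as solutions of a semilinear equation\<close>

definition vec_conj :: "'a ^ 5 \<Rightarrow> 'a ^ 5" where "vec_conj z = (\<chi> j. (z $ j) ^ t)"

text \<open>This is the Gram matrix of the polar form applied to \<open>z\<close>.\<close>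

definition polar_vec :: "'a poly5 \<Rightarrow> 'a ^ 5 \<Rightarrow> 'a ^ 5" where
  "polar_vec f z = (\<chi> j. polar_form f (axis j 1) z)"

lemma vec_conj_simps:
  "vec_conj (x + y) = vec_conj x + vec_conj y" "vec_conj (c *s x) = c ^ t *s vec_conj x"
  "vec_conj (vec_conj x) = x"
  by (simp_all add: vec_conj_def vec_eq_iff frobenius_add power_mult_distrib)

lemma vec_conj_eq_0_iff: "vec_conj x = 0 \<longleftrightarrow> x = 0"
  using t_ge_2 by (simp add: vec_conj_def vec_eq_iff)

lemma polar_vec_linear:
  assumes "f \<in> quadratic_forms"
  shows "polar_vec f (x + y) = polar_vec f x + polar_vec f y" "polar_vec f (c *s x) = c *s polar_vec f x"
  by (simp_all add: polar_vec_def vec_eq_iff polar_form_add_right[OF assms] polar_form_scale_right[OF assms])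

lemma vec_conj_twisted_radical:
  assumes "z \<in> twisted_radical f a"
  shows "vec_conj z = (- a) *s polar_vec f z"
proof -
  have "vec_conj z $ j = - a * polar_form f (axis j 1) z" for j
  proof -
    have "h (axis j 1) z + a * polar_form f (axis j 1) z = 0"
      using assms by (simp add: twisted_radical_def)
    then show ?thesis by (simp add: h_axis vec_conj_def eq_neg_iff_add_eq_0)
  qed
  then show ?thesis by (simp add: vec_eq_iff polar_vec_def)
qed

lemma twisted_radical_diff:
  assumes f: "f \<in> quadratic_forms" and "x \<in> twisted_radical f a" "y \<in> twisted_radical f a"
  shows "x - y \<in> twisted_radical f a"
proof -
  have zero: "h u x + a * polar_form f u x = 0" "h u y + a * polar_form f u y = 0" for u
    using assms(2,3) by (simp_all add: twisted_radical_def)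
  have "h u (x - y) + a * polar_form f u (x - y) = 0" for u
  proof -
    have "h u (x - y) = h u x - h u y"
      using h_add_right[of u "x - y" y] by (simp add: eq_diff_eq)
    moreover have "polar_form f u (x - y) = polar_form f u x - polar_form f u y"
      using polar_form_add_right[OF f, of u "x - y" y] by (simp add: eq_diff_eq)
    ultimately have "h u (x - y) + a * polar_form f u (x - y)
        = (h u x + a * polar_form f u x) - (h u y + a * polar_form f u y)"
      by (simp only: right_diff_distrib add_diff_add)
    then show ?thesis by (simp only: zero) simp
  qed
  then show ?thesis by (simp add: twisted_radical_def)
qed

definition \<omega> :: 'a where "\<omega> = (SOME w. w \<notin> Ft)"

lemma \<omega>: "\<omega> ^ t \<noteq> \<omega>"
proof -
  have "Ft \<noteq> UNIV"
  proof
    assume "Ft = UNIV"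
    then have "card Ft = CARD('a)" by (rule arg_cong)
    then have "t = t * t" unfolding card_Ft card_field power2_eq_square .
    moreover have "2 * t \<le> t * t" using t_ge_2 by (rule mult_le_mono1)
    ultimately show False using t_ge_2 by linarith
  qed
  then have "\<exists>w. w \<notin> Ft" by blast
  then have "\<omega> \<notin> Ft" unfolding \<omega>_def by (rule someI_ex)
  then show ?thesis by (simp add: Ft_def)
qed

text \<open>The radical is a space over \<open>Ft\<close> only. As 1 and \<open>\<omega>\<close>
  form a basis of the field over \<open>Ft\<close>, this is its span over the whole field.\<close>

definition radical_span :: "'a poly5 \<Rightarrow> 'a \<Rightarrow> ('a ^ 5) set" where
  "radical_span f a = (\<lambda>(x, y). x + \<omega> *s y) ` (twisted_radical f a \<times> twisted_radical f a)"

text \<open>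
  The elements of \<^term>\<open>twisted_radical f a\<close> satisfy the semilinear equation
  \<open>vec_conj z = - a *s polar_vec f z\<close>, so a relation \<open>x = - \<omega> *s y\<close> between two of them
  forces \<open>\<omega> ^ t = \<omega>\<close> or \<open>y = 0\<close>.
\<close>

lemma card_radical_span:
  assumes f: "f \<in> quadratic_forms"
  shows "card (radical_span f a) = (card (twisted_radical f a))\<^sup>2"
proof -
  let ?K = "twisted_radical f a"
  have "card (radical_span f a) = card (?K \<times> ?K)"
    unfolding radical_span_def
  proof (rule card_image, rule inj_onI)
    have 0: "y = 0" if "x \<in> ?K" "y \<in> ?K" "x = (- \<omega>) *s y" for x y
    proof -
      have "(- (\<omega> ^ t)) *s vec_conj y = vec_conj x"
        by (simp only: that(3) vec_conj_simps frobenius_minus)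
      also have "\<dots> = (- a) *s polar_vec f x"
        by (rule vec_conj_twisted_radical[OF that(1)])
      also have "\<dots> = (- \<omega>) *s ((- a) *s polar_vec f y)"
        by (simp only: that(3) polar_vec_linear(2)[OF f] vec.scale_scale mult.commute)
      also have "(- a) *s polar_vec f y = vec_conj y"
        by (rule vec_conj_twisted_radical[OF that(2), symmetric])
      finally have "\<omega> ^ t = \<omega> \<or> vec_conj y = 0"
        by (simp only: vec.scale_cancel_right neg_equal_iff_equal)
      then show ?thesis using \<omega> vec_conj_eq_0_iff by blast
    qed
    show "p = r" if "p \<in> ?K \<times> ?K" "r \<in> ?K \<times> ?K"
      "(case p of (x, y) \<Rightarrow> x + \<omega> *s y) = (case r of (x, y) \<Rightarrow> x + \<omega> *s y)" for p r
    proof -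
      obtain x y where p: "p = (x, y)" by (cases p)
      obtain x' y' where r: "r = (x', y')" by (cases r)
      have mem: "x \<in> ?K" "y \<in> ?K" "x' \<in> ?K" "y' \<in> ?K" and eq: "x + \<omega> *s y = x' + \<omega> *s y'"
        using that by (simp_all add: p r)
      have "x - x' = (- \<omega>) *s (y - y')" using eq by (simp add: vector_ssub_ldistrib algebra_simps)
      then have "y - y' = 0"
        using 0 twisted_radical_diff[OF f] mem by blast
      then show ?thesis using eq by (simp add: p r)
    qed
  qed
  then show ?thesis by (simp add: card_cartesian_product power2_eq_square)
qed

text \<open>
  On \<^term>\<open>radical_span f a\<close> the linear map \<open>z \<mapsto> vec_conj (polar_vec f (vec_conj (polar_vec f z)))\<close>
  is multiplication by the inverse of the norm of \<open>a\<close>; different norms give independent eigenspaces.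
\<close>

lemma radical_span_eigen:
  assumes f: "f \<in> quadratic_forms" and a: "a \<noteq> 0" and z: "z \<in> radical_span f a"
  shows "vec_conj (polar_vec f (vec_conj (polar_vec f z))) = inverse (a ^ (t + 1)) *s z"
proof -
  have eigen: "vec_conj (polar_vec f (vec_conj (polar_vec f x))) = inverse (a ^ (t + 1)) *s x"
    if x: "x \<in> twisted_radical f a" for x
  proof -
    let ?b = "inverse (- a)"
    have M: "polar_vec f x = ?b *s vec_conj x"
      using a by (simp add: vec_conj_twisted_radical[OF x] del: vector_smult_lneg)
    then have "vec_conj (polar_vec f (vec_conj (polar_vec f x))) = (?b ^ t * ?b) ^ t *s x"
      by (simp only: vec_conj_simps polar_vec_linear(2)[OF f] vec.scale_scale)
    also have "(?b ^ t * ?b) ^ t = inverse ((- a) * (- a) ^ t)"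
      by (simp only: power_mult_distrib frobenius_involution power_inverse inverse_mult_distrib)
    also have "(- a) * (- a) ^ t = a ^ (t + 1)" by (simp add: frobenius_minus)
    finally show ?thesis .
  qed
  obtain x y where xy: "x \<in> twisted_radical f a" "y \<in> twisted_radical f a" "z = x + \<omega> *s y"
    using z by (auto simp: radical_span_def)
  \<comment> \<open>The two conjugations make the composite map linear over the whole field, so the
    eigenvalue equation passes from \<open>x\<close> and \<open>y\<close> to
    \<open>x + \<omega> *s y\<close>.\<close>
  show ?thesis
    unfolding xy(3) polar_vec_linear[OF f] vec_conj_simps eigen[OF xy(1)] eigen[OF xy(2)]
      frobenius_involution vector_add_ldistrib
    by (simp add: mult.commute)
qed

lemma radical_span_diff:
  assumes f: "f \<in> quadratic_forms" and "u \<in> radical_span f a" "v \<in> radical_span f a"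
  shows "u - v \<in> radical_span f a"
proof -
  obtain x y where u: "x \<in> twisted_radical f a" "y \<in> twisted_radical f a" "u = x + \<omega> *s y"
    using assms(2) by (auto simp: radical_span_def)
  obtain x' y' where v: "x' \<in> twisted_radical f a" "y' \<in> twisted_radical f a" "v = x' + \<omega> *s y'"
    using assms(3) by (auto simp: radical_span_def)
  have "u - v = (x - x') + \<omega> *s (y - y')"
    by (simp add: u v vector_ssub_ldistrib algebra_simps)
  moreover have "(x - x', y - y') \<in> twisted_radical f a \<times> twisted_radical f a"
    using twisted_radical_diff[OF f] u v by blast
  ultimately show ?thesis
    unfolding radical_span_def by (intro image_eqI[of _ _ "(x - x', y - y')"]) simp_all
qed

lemma card_twisted_radical_le:
  assumes f: "f \<in> quadratic_forms"
  shows "card (twisted_radical f a) \<le> t ^ 5"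
proof -
  have "card (radical_span f a) \<le> card (UNIV :: ('a ^ 5) set)" by (rule card_mono) simp_all
  then have "(card (twisted_radical f a))\<^sup>2 \<le> (t ^ 5)\<^sup>2"
    by (simp only: card_radical_span[OF f] card_space)
  then show ?thesis by (rule power2_le_imp_le) simp
qed

text \<open>Different eigenvalues force the two spans to meet in 0, so their product embeds into the
  space by subtraction. Both spans have the squared size of the radicals, whence the square root
  \<open>t ^ 5\<close>.\<close>

lemma card_twisted_radical_mult_le:
  assumes f: "f \<in> quadratic_forms" and ab: "a \<noteq> 0" "b \<noteq> 0" "a ^ (t + 1) \<noteq> b ^ (t + 1)"
  shows "card (twisted_radical f a) * card (twisted_radical f b) \<le> t ^ 5"
proof -
  let ?A = "radical_span f a" and ?B = "radical_span f b"
  have disjoint: "u = 0" if "u \<in> ?A" "u \<in> ?B" for u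
  proof -
    have "inverse (a ^ (t + 1)) *s u = inverse (b ^ (t + 1)) *s u"
      using radical_span_eigen[OF f ab(1) that(1)] radical_span_eigen[OF f ab(2) that(2)] by (simp only:)
    then have "inverse (a ^ (t + 1)) = inverse (b ^ (t + 1)) \<or> u = 0"
      by (simp only: vec.scale_cancel_right)
    then show ?thesis using ab(3) by (simp only: inverse_eq_iff_eq) blast
  qed
  have "card (?A \<times> ?B) \<le> card (UNIV :: ('a ^ 5) set)"
  proof (rule card_inj_on_le)
    show "inj_on (\<lambda>(u, v). u - v) (?A \<times> ?B)"
    proof (rule inj_onI)
      show "p = r" if "p \<in> ?A \<times> ?B" "r \<in> ?A \<times> ?B"
        "(case p of (u, v) \<Rightarrow> u - v) = (case r of (u, v) \<Rightarrow> u - v)" for p r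
      proof -
        obtain u v where p: "p = (u, v)" by (cases p)
        obtain u' v' where r: "r = (u', v')" by (cases r)
        have mem: "u \<in> ?A" "v \<in> ?B" "u' \<in> ?A" "v' \<in> ?B" and eq: "u - v = u' - v'"
          using that by (simp_all add: p r)
        have "u - u' = v - v'" using eq by (simp add: algebra_simps)
        then have "u - u' \<in> ?B" by (simp only: radical_span_diff[OF f mem(2,4)])
        with radical_span_diff[OF f mem(1,3)] have "u - u' = 0" by (rule disjoint)
        then show ?thesis using eq by (simp add: p r)
      qed
    qed
  qed simp_all
  then have "(card (twisted_radical f a) * card (twisted_radical f b))\<^sup>2 \<le> (t ^ 5)\<^sup>2"
    by (simp only: card_cartesian_product card_radical_span[OF f] card_space power_mult_distrib)
  then show ?thesis by (rule power2_le_imp_le) simp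
qed

text \<open>Let \<open>b\<close> have the largest radical among nonzero scalars. At most
  \<open>t + 1\<close> scalars share its norm, and they obey the general bound; each of the others
  has a radical no larger than that of \<open>b\<close>, so the product bound limits its square. The
  summand 1 comes from \<open>a = 0\<close>.\<close>

lemma sum_sqrt_card_twisted_radical:
  assumes f: "f \<in> quadratic_forms"
  shows "(\<Sum>a\<in>UNIV. sqrt (real (card (twisted_radical f a))))
    \<le> 1 + 2 * (real t ^ 2 - 1) * (real t * sqrt (real t))"
proof -
  let ?k = "\<lambda>a. card (twisted_radical f a)"
  let ?c = "real t * sqrt (real t)"
  have t: "real t \<ge> 2" using t_ge_2 by simp
  have sqrt5: "sqrt (real t ^ 5) = real t * ?c"
    by (rule real_sqrt_unique) (use t in \<open>simp_all add: power_mult_distrib power_numeral_reduce\<close>)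
  have sqrt3: "sqrt (real t ^ 3) = ?c"
    by (rule real_sqrt_unique) (use t in \<open>simp_all add: power_mult_distrib power_numeral_reduce\<close>)
  define S where "S = UNIV - {0 :: 'a}"
  have cS: "card S = t ^ 2 - 1" by (simp add: S_def card_field)
  then have "real (card S) = real t ^ 2 - 1" using t_ge_2 by (simp add: of_nat_diff)
  have "1 \<in> S" by (simp add: S_def)
  then have "Max (?k ` S) \<in> ?k ` S" by (intro Max_in) auto
  then obtain b where b: "b \<in> S" "?k b = Max (?k ` S)" by auto
  have max: "?k a \<le> ?k b" if "a \<in> S" for a unfolding b(2) using that by simp
  define A where "A = {a \<in> S. a ^ (t + 1) = b ^ (t + 1)}"
  have "A \<subseteq> S" by (auto simp: A_def)
  have "card A \<le> card {a :: 'a. a ^ (t + 1) = b ^ (t + 1)}"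
    by (rule card_mono) (auto simp: A_def)
  then have cA: "card A \<le> t + 1" using card_norm_fibre_le[of "b ^ (t + 1)"] by linarith
  have "sqrt (real (?k a)) \<le> real t * ?c" for a
    unfolding sqrt5[symmetric] using card_twisted_radical_le[OF f, of a]
    by (simp flip: of_nat_power)
  then have sumA: "(\<Sum>a\<in>A. sqrt (real (?k a))) \<le> real (card A) * (real t * ?c)"
    by (intro sum_bounded_above)
  have "sqrt (real (?k a)) \<le> ?c" if a: "a \<in> S - A" for a
  proof -
    have "?k a * ?k a \<le> ?k a * ?k b" using max a by simp
    also have "\<dots> \<le> t ^ 5"
      using a b(1) by (intro card_twisted_radical_mult_le[OF f]) (auto simp: S_def A_def)
    \<comment> \<open>Rounding up to an even exponent makes the root an integer power; the bound
      \<open>t ^ 3\<close> is still strong enough.\<close>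
    also have "\<dots> \<le> t ^ 6" using t_ge_2 by (intro power_increasing) simp_all
    finally have "(?k a)\<^sup>2 \<le> (t ^ 3)\<^sup>2" by (simp add: power2_eq_square flip: power_add)
    then have "?k a \<le> t ^ 3" by (rule power2_le_imp_le) simp
    then show ?thesis unfolding sqrt3[symmetric] by (simp flip: of_nat_power)
  qed
  then have sumB: "(\<Sum>a\<in>S - A. sqrt (real (?k a))) \<le> real (card (S - A)) * ?c"
    by (intro sum_bounded_above)
  have cB: "real (card (S - A)) = real t ^ 2 - 1 - real (card A)"
    using card_mono[OF _ \<open>A \<subseteq> S\<close>] \<open>A \<subseteq> S\<close> \<open>real (card S) = real t ^ 2 - 1\<close>
    by (simp add: card_Diff_subset of_nat_diff)
  have "(\<Sum>a\<in>UNIV. sqrt (real (?k a))) = sqrt (real (?k 0)) + (\<Sum>a\<in>S. sqrt (real (?k a)))"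
    unfolding S_def by (rule sum.remove) simp_all
  also have "(\<Sum>a\<in>S. sqrt (real (?k a))) = (\<Sum>a\<in>S - A. sqrt (real (?k a))) + (\<Sum>a\<in>A. sqrt (real (?k a)))"
    using \<open>A \<subseteq> S\<close> by (rule sum.subset_diff) simp
  also have "\<dots> \<le> real (card (S - A)) * ?c + real (card A) * (real t * ?c)"
    using sumB sumA by (rule add_mono)
  also have "\<dots> = (real t ^ 2 - 1) * ?c + real (card A) * ((real t - 1) * ?c)"
    unfolding cB by (simp add: algebra_simps)
  also have "real (card A) * ((real t - 1) * ?c) \<le> (real t + 1) * ((real t - 1) * ?c)"
    using cA t by (intro mult_right_mono) simp_all
  also have "sqrt (real (?k 0)) + ((real t ^ 2 - 1) * ?c + (real t + 1) * ((real t - 1) * ?c))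
      = 1 + 2 * (real t ^ 2 - 1) * ?c"
    by (simp add: twisted_radical_0 power2_eq_square algebra_simps)
  finally show ?thesis by simp
qed

text \<open>The right side is the room that \<open>max_count\<close> leaves for the radical terms in
  the averaging identity. The bound \<open>sqrt x \<le> x / 2\<close> needs
  \<open>x \<ge> 4\<close>, so 2 and 3 are treated numerically.\<close>

lemma max_count_estimate:
  fixes x :: real
  assumes x: "x = real t"
  shows "(x - 1) * (1 + 2 * (x ^ 2 - 1) * (x * sqrt x)) < x ^ 5 - 2 * x ^ 3 + 2 * x ^ 2 - x - 1"
proof -
  consider "t = 2" | "t = 3" | "t \<ge> 4" using t_ge_2 by linarith
  then show ?thesis
  proof cases
    case 1
    have "sqrt 2 < 3 / 2" by (rule real_less_lsqrt) (simp_all add: power2_eq_square)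
    then show ?thesis by (simp add: x 1)
  next
    case 2
    have "sqrt 3 < 2" by (rule real_less_lsqrt) simp_all
    then show ?thesis by (simp add: x 2)
  next
    case 3
    then have t: "x \<ge> 4" by (simp add: x)
    have "sqrt x \<le> x / 2"
      by (rule real_le_lsqrt) (use t in \<open>simp_all add: power2_eq_square\<close>)
    then have "(x - 1) * (1 + 2 * (x ^ 2 - 1) * (x * sqrt x)) \<le> (x - 1) * (1 + 2 * (x ^ 2 - 1) * (x * (x / 2)))"
      using t by (intro mult_left_mono add_left_mono) (simp_all add: one_le_power)
    also have "\<dots> = x ^ 5 - 2 * x ^ 3 + 2 * x ^ 2 - x - 1 - (x ^ 3 * (x - 1) + x * (x - 2))"
      by (simp add: algebra_simps power_numeral_reduce)
    also have "\<dots> < x ^ 5 - 2 * x ^ 3 + 2 * x ^ 2 - x - 1"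
    proof -
      have "0 < x ^ 3 * (x - 1) + x * (x - 2)"
        using t by (intro add_pos_pos mult_pos_pos) simp_all
      then show ?thesis by linarith
    qed
    finally show ?thesis .
  qed
qed

text \<open>The bounds for the twisted forms are summed over \<open>a\<close> and inserted into
  \<open>sum_twisted_zeros\<close>, whose last term is controlled by the assumption, in powers of
  \<open>t\<close> equal to \<open>t ^ 8 + t ^ 6\<close>.\<close>

theorem card_isotropic_quadric:
  assumes f: "f \<in> quadratic_forms"
    and small: "card {x. eval_poly f x = 0} \<le> CARD('a) ^ 4 + CARD('a) ^ 3"
  shows "int (card {x. H x = 0 \<and> eval_poly f x = 0}) < max_count"
proof -
  let ?N = "real (card {x. H x = 0 \<and> eval_poly f x = 0})"
  let ?x = "real t"
  let ?Z = "\<lambda>a. real (card {x. twisted f a x = 0})" and ?r = "\<lambda>a. sqrt (real (card (twisted_radical f a)))"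
  have x: "?x \<ge> 2" using t_ge_2 by simp
  have "real (card {x. eval_poly f x = 0}) \<le> real (CARD('a) ^ 4 + CARD('a) ^ 3)"
    using small by (rule of_nat_mono)
  then have Nf: "real (card {x. eval_poly f x = 0}) \<le> ?x ^ 8 + ?x ^ 6"
    by (simp add: card_field flip: power_mult)
  have "(\<Sum>a\<in>UNIV. ?x * ?Z a - ?x ^ 10) \<le> (\<Sum>a\<in>UNIV. (?x - 1) * ?x ^ 5 * ?r a)"
    by (intro sum_mono card_twisted_zeros[OF f])
  then have "?x * (\<Sum>a\<in>UNIV. ?Z a) \<le> ?x ^ 12 + (?x - 1) * ?x ^ 5 * (\<Sum>a\<in>UNIV. ?r a)"
    by (simp add: sum_subtractf card_field sum_distrib_left flip: power_add)
  also have "\<dots> \<le> ?x ^ 12 + (?x - 1) * ?x ^ 5 * (1 + 2 * (?x ^ 2 - 1) * (?x * sqrt ?x))"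
    using x by (intro add_left_mono mult_left_mono sum_sqrt_card_twisted_radical[OF f]) simp_all
  also have "\<dots> = ?x ^ 12 + ?x ^ 5 * ((?x - 1) * (1 + 2 * (?x ^ 2 - 1) * (?x * sqrt ?x)))"
    by (simp only: mult.commute mult.left_commute)
  also have "\<dots> < ?x ^ 12 + ?x ^ 5 * (?x ^ 5 - 2 * ?x ^ 3 + 2 * ?x ^ 2 - ?x - 1)"
    using x max_count_estimate[OF refl] by (intro add_strict_left_mono mult_strict_left_mono) simp_all
  finally have 1: "?x * (\<Sum>a\<in>UNIV. ?Z a) < ?x ^ 12 + ?x ^ 5 * (?x ^ 5 - 2 * ?x ^ 3 + 2 * ?x ^ 2 - ?x - 1)" .
  have "real (t\<^sup>2 * card {x. H x = 0 \<and> eval_poly f x = 0} + t ^ 11)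
      = real ((\<Sum>a\<in>UNIV. card {x. twisted f a x = 0}) + t * card {x. eval_poly f x = 0})"
    by (simp only: sum_twisted_zeros)
  then have 2: "?x ^ 2 * ?N + ?x ^ 11 = (\<Sum>a\<in>UNIV. ?Z a) + ?x * real (card {x. eval_poly f x = 0})"
    by simp
  have "?x * (?x ^ 2 * ?N + ?x ^ 11)
      = ?x * (\<Sum>a\<in>UNIV. ?Z a) + ?x * (?x * real (card {x. eval_poly f x = 0}))"
    unfolding 2 by (rule distrib_left)
  also have "\<dots> \<le> ?x * (\<Sum>a\<in>UNIV. ?Z a) + ?x * (?x * (?x ^ 8 + ?x ^ 6))"
    using Nf by (intro add_left_mono mult_left_mono) simp_all
  also have "\<dots> < ?x ^ 12 + ?x ^ 5 * (?x ^ 5 - 2 * ?x ^ 3 + 2 * ?x ^ 2 - ?x - 1) + ?x * (?x * (?x ^ 8 + ?x ^ 6))"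
    using 1 by (rule add_strict_right_mono)
  finally have "?x ^ 3 * ?N < ?x ^ 3 * (2 * ?x ^ 7 - ?x ^ 5 + 2 * ?x ^ 4 - ?x ^ 3 - ?x ^ 2)"
    by (simp add: algebra_simps power_numeral_reduce)
  then have "?N < 2 * ?x ^ 7 - ?x ^ 5 + 2 * ?x ^ 4 - ?x ^ 3 - ?x ^ 2"
    using x by (simp only: mult_less_cancel_left_pos zero_less_power)
  also have "\<dots> = real_of_int max_count" by (simp add: max_count_def)
  finally show ?thesis by linarith
qed

end

section \<open>Minimum weight codewords\<close>

lemma span_in_proj_iff:
  fixes x :: "'a::field ^ 5"
  assumes "vec.subspace U" "x \<noteq> 0"
  shows "vec.span {x} \<in> proj U \<longleftrightarrow> x \<in> U"
proof
  assume "x \<in> U"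
  then have "vec.span {x} \<subseteq> U" using assms(1) by (intro vec.span_minimal) simp_all
  then show "vec.span {x} \<in> proj U"
    using assms(2) by (simp add: proj_def points_def vec.subspace_span)
next
  assume "vec.span {x} \<in> proj U"
  then have "vec.span {x} \<subseteq> U" by (simp add: proj_def)
  moreover have "x \<in> vec.span {x}" by (rule vec.span_base) simp
  ultimately show "x \<in> U" by blast
qed

lemma span_in_zero_set_iff:
  assumes "f \<in> quadratic_forms" "x \<noteq> 0"
  shows "vec.span {x} \<in> zero_set f \<longleftrightarrow> eval_poly f x = 0"
proof
  assume "eval_poly f x = 0"
  then have "eval_poly f y = 0" if "y \<in> vec.span {x}" for y
    using that by (auto simp: vec.span_singleton eval_poly_scale[OF assms(1)])
  moreover have "vec.span {x} \<in> points" using assms(2) by (simp add: points_def vec.subspace_span)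
  ultimately show "vec.span {x} \<in> zero_set f" by (simp add: zero_set_def)
next
  assume "vec.span {x} \<in> zero_set f"
  moreover have "x \<in> vec.span {x}" by (rule vec.span_base) simp
  ultimately show "eval_poly f x = 0" by (simp add: zero_set_def)
qed

lemma eval_poly_0: "f \<in> quadratic_forms \<Longrightarrow> eval_poly f 0 = 0"
  using eval_poly_scale[of f 0 0] by simp

lemma points_cases:
  assumes "P \<in> points"
  obtains x where "x \<noteq> 0" "P = vec.span {x}"
proof -
  obtain x where x: "x \<in> P" "x \<noteq> 0" using points_nonzero[OF assms] .
  then have "P = vec.span {x}"
    using points_eq_multiples[OF assms] by (simp add: vec.span_singleton)
  with x that show ?thesis by blast
qed

lemma zero_set_eq_proj_Un_iff:
  fixes f :: "'a::field poly5"
  assumes f: "f \<in> quadratic_forms" and sub: "vec.subspace U" "vec.subspace V"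
  shows "zero_set f = proj U \<union> proj V \<longleftrightarrow> {x. eval_poly f x = 0} = U \<union> V"
proof
  assume eq: "zero_set f = proj U \<union> proj V"
  have "eval_poly f x = 0 \<longleftrightarrow> x \<in> U \<union> V" for x
  proof (cases "x = 0")
    case True
    then show ?thesis using eval_poly_0[OF f] sub by (simp add: vec.subspace_0)
  next
    case False
    have "eval_poly f x = 0 \<longleftrightarrow> vec.span {x} \<in> proj U \<union> proj V"
      using span_in_zero_set_iff[OF f False] by (simp only: eq)
    then show ?thesis
      using span_in_proj_iff[OF sub(1) False] span_in_proj_iff[OF sub(2) False] by blast
  qed
  then show "{x. eval_poly f x = 0} = U \<union> V" by blast
next
  assume eq: "{x. eval_poly f x = 0} = U \<union> V"
  have *: "P \<in> zero_set f \<longleftrightarrow> P \<in> proj U \<union> proj V" if P: "P \<in> points" for P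
  proof -
    obtain x where x: "x \<noteq> 0" "P = vec.span {x}" using points_cases[OF P] .
    have "eval_poly f x = 0 \<longleftrightarrow> x \<in> U \<union> V" using eq by blast
    then show ?thesis
      unfolding x(2) using span_in_zero_set_iff[OF f x(1)]
        span_in_proj_iff[OF sub(1) x(1)] span_in_proj_iff[OF sub(2) x(1)] by blast
  qed
  have "zero_set f \<subseteq> points" "proj U \<union> proj V \<subseteq> points" by (auto simp: zero_set_def proj_def)
  with * show "zero_set f = proj U \<union> proj V" by blast
qed

text \<open>The form \<open>x $ 0 * x $ 1\<close> serves as a witness that the maximal count is
  attained.\<close>

definition coordinate_product :: "'a::field poly5" where
  "coordinate_product = Poly_Mapping.single (Poly_Mapping.single 0 1 + Poly_Mapping.single 1 1) 1"

lemma coordinate_product_quadratic: "coordinate_product \<in> quadratic_forms"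
  by (simp add: coordinate_product_def quadratic_forms_def lookup_add lookup_single sum.distrib when_def)

lemma eval_coordinate_product: "eval_poly coordinate_product x = x $ 0 * x $ 1"
proof -
  have single: "(\<Prod>i\<in>UNIV. (x $ i) ^ Poly_Mapping.lookup (Poly_Mapping.single j 1) i) = x $ j" for j
  proof -
    have "(\<Prod>i\<in>UNIV. (x $ i) ^ Poly_Mapping.lookup (Poly_Mapping.single j 1) i)
        = (\<Prod>i\<in>UNIV. if i = j then x $ i else 1)"
      by (intro prod.cong) (auto simp: lookup_single when_def)
    also have "\<dots> = x $ j" by simp
    finally show ?thesis .
  qed
  have "eval_poly coordinate_product x
      = (\<Prod>i\<in>UNIV. (x $ i) ^ Poly_Mapping.lookup (Poly_Mapping.single 0 1 + Poly_Mapping.single 1 1) i)"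
    by (simp add: eval_poly_def coordinate_product_def)
  also have "\<dots> = x $ 0 * x $ 1"
    by (simp only: lookup_add power_add prod.distrib single)
  finally show ?thesis .
qed

section \<open>From zero counts to weights\<close>

context hermitian_field
begin

abbreviation (input) zero_count :: "'a poly5 \<Rightarrow> int" where
  "zero_count f \<equiv> int (card {x. H x = 0 \<and> eval_poly f x = 0})"

definition optimal_pair :: "'a poly5 \<Rightarrow> bool" where
  "optimal_pair f \<longleftrightarrow> (\<exists>U V. hyperplane U \<and> hyperplane V \<and> U \<noteq> V \<and>
          zero_set f = proj U \<union> proj V \<and>
          \<not> tangent_hyperplane t U \<and> \<not> tangent_hyperplane t V \<and>
          nonsingular_plane_section t (U \<inter> V))"

lemma zero_count_optimal_pair:
  assumes f: "f \<in> quadratic_forms" and "optimal_pair f"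
  shows "zero_count f = max_count"
proof -
  obtain U V where UV: "hyperplane U" "hyperplane V" "U \<noteq> V" "zero_set f = proj U \<union> proj V"
    "\<not> tangent_hyperplane t U \<and> \<not> tangent_hyperplane t V \<and> nonsingular_plane_section t (U \<inter> V)"
    using assms(2) unfolding optimal_pair_def by blast
  have sub: "vec.subspace U" "vec.subspace V" using UV by (simp_all add: hyperplane_def)
  have eq: "{x. eval_poly f x = 0} = U \<union> V"
    using zero_set_eq_proj_Un_iff[OF f sub] UV(4) by (rule iffD1)
  then have "{x. H x = 0 \<and> eval_poly f x = 0} = {x. H x = 0 \<and> x \<in> U \<union> V}" by blast
  then show ?thesis
    using card_isotropic_two_hyperplanes(1)[OF UV(1-3,5)] by (simp only:)
qed

text \<open>The dichotomy leaves three cases: few zeros, a repeated hyperplane, and two distinct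
  hyperplanes violating one of the optimality conditions.\<close>

lemma zero_count_le:
  assumes f: "f \<in> quadratic_forms" and nz: "eval_poly f w \<noteq> 0" and "\<not> optimal_pair f"
  shows "zero_count f < max_count"
  using f nz
proof (cases rule: quadric_dichotomy)
  case small
  then show ?thesis by (rule card_isotropic_quadric[OF f])
next
  case (split U V)
  have sub: "vec.subspace U" "vec.subspace V" using split by (simp_all add: hyperplane_def)
  have eq: "{x. H x = 0 \<and> eval_poly f x = 0} = {x. H x = 0 \<and> x \<in> U \<union> V}"
    using split(3) by blast
  show ?thesis
  proof (cases "U = V")
    case True
    then have "{x. H x = 0 \<and> eval_poly f x = 0} = {x \<in> U. H x = 0}" using eq by blast
    then show ?thesis using card_isotropic_one_hyperplane[OF split(1)] by (simp only:)
  next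
    case False
    have "zero_set f = proj U \<union> proj V"
      using zero_set_eq_proj_Un_iff[OF f sub] split(3) by (rule iffD2)
    then have "\<not> (\<not> tangent_hyperplane t U \<and> \<not> tangent_hyperplane t V \<and> nonsingular_plane_section t (U \<inter> V))"
      using \<open>\<not> optimal_pair f\<close> split False unfolding optimal_pair_def by blast
    from card_isotropic_two_hyperplanes(2)[OF split(1,2) False this]
    show ?thesis unfolding eq .
  qed
qed

text \<open>The unit vectors lying in a coordinate subspace form an orthonormal basis of it. This
  yields non-tangency of the coordinate hyperplanes and nonsingularity on their intersection
  alike.\<close>

lemma herm_radical_coordinate_subspace:
  "herm_radical t {x :: 'a ^ 5. \<forall>j\<in>J. x $ j = 0} = {0}"
proof -
  let ?W = "{x :: 'a ^ 5. \<forall>j\<in>J. x $ j = 0}"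
  have "z = 0" if z: "z \<in> herm_radical t ?W" for z
  proof -
    have "z $ i = 0" for i
    proof (cases "i \<in> J")
      case True
      then show ?thesis using z by (simp add: herm_radical_def)
    next
      case False
      then have "axis i 1 \<in> ?W" by (auto simp: axis_def)
      then have "h z (axis i 1) = 0" using z by (simp add: herm_radical_def)
      then have "h (axis i 1) z = 0" by (simp only: h_eq_0_swap)
      then show ?thesis using t_ge_2 by (simp add: h_axis)
    qed
    then show ?thesis by (simp add: vec_eq_iff)
  qed
  moreover have "0 \<in> herm_radical t ?W" by (simp add: herm_radical_def)
  ultimately show ?thesis by blast
qed

lemma optimal_pair_coordinate_product: "optimal_pair coordinate_product"
proof -
  let ?W = "\<lambda>J. {x :: 'a ^ 5. \<forall>j\<in>J. x $ j = 0}"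
  have W: "hyperplane (?W {k})" for k
  proof -
    have "hyperplane {x :: 'a ^ 5. x $ k = 0}"
      by (rule hyperplane_kernel[where y = "axis k 1"]) simp_all
    then show ?thesis by simp
  qed
  have "axis 1 1 \<in> ?W {0}" "axis 1 1 \<notin> ?W {1}" by (simp_all add: axis_def)
  then have ne: "?W {0} \<noteq> ?W {1}" by blast
  have int: "?W {0} \<inter> ?W {1} = ?W {0, 1}" by auto
  have nt: "\<not> tangent_hyperplane t (?W {k})" for k
    using tangent_hyperplane_iff[OF W] herm_radical_coordinate_subspace by blast
  have "nonsingular_plane_section t (?W {0} \<inter> ?W {1})"
    using dim_hyperplanes_Int[OF W W ne]
    unfolding nonsingular_plane_section_def herm_rank_def int herm_radical_coordinate_subspace
    by simp
  moreover have "zero_set (coordinate_product :: 'a poly5) = proj (?W {0}) \<union> proj (?W {1})"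
  proof (rule iffD2[OF zero_set_eq_proj_Un_iff[OF coordinate_product_quadratic]])
    show "vec.subspace (?W {0})" "vec.subspace (?W {1})" using W by (simp_all only: hyperplane_def)
    show "{x :: 'a ^ 5. eval_poly coordinate_product x = 0} = ?W {0} \<union> ?W {1}"
      by (auto simp: eval_coordinate_product)
  qed
  ultimately show ?thesis
    using W ne nt unfolding optimal_pair_def by blast
qed

lemma zero_count_eq:
  assumes f: "f \<in> quadratic_forms"
  shows "zero_count f = 1 + (int t ^ 2 - 1) * int (card (herm_variety t \<inter> zero_set f))"
proof -
  have "{P \<in> herm_variety t. P \<subseteq> {x. eval_poly f x = 0}} = herm_variety t \<inter> zero_set f"
    by (auto simp: herm_variety_def zero_set_def)
  moreover have "int (t ^ 2 - 1) = int t ^ 2 - 1" using t_ge_2 by (simp add: of_nat_diff)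
  ultimately show ?thesis
    using card_isotropic_points[of "{x. eval_poly f x = 0}"] eval_poly_0[OF f]
    by (simp add: eval_poly_scale[OF f])
qed

lemma norm_minus_one_pos: "0 < int t ^ 2 - 1"
  using one_less_power[of "int t" 2] t_ge_2 by simp

lemma weight_le_iff:
  assumes "f \<in> quadratic_forms" "g \<in> quadratic_forms"
  shows "weight t (codeword t f) \<le> weight t (codeword t g) \<longleftrightarrow> zero_count g \<le> zero_count f"
proof -
  let ?M = "\<lambda>f. card (herm_variety t \<inter> zero_set f :: ('a ^ 5) set set)"
  \<comment> \<open>The weights are truncated differences, so they reverse the order only because
    neither count exceeds the size of the variety.\<close>
  have "?M f \<le> card (herm_variety t :: ('a ^ 5) set set)" "?M g \<le> card (herm_variety t :: ('a ^ 5) set set)"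
    by (intro card_mono; simp)+
  then have "weight t (codeword t f) \<le> weight t (codeword t g) \<longleftrightarrow> ?M g \<le> ?M f"
    unfolding weight_codeword[OF assms(1)] weight_codeword[OF assms(2)] by linarith
  also have "\<dots> \<longleftrightarrow> zero_count g \<le> zero_count f"
    unfolding zero_count_eq[OF assms(1)] zero_count_eq[OF assms(2)]
    using norm_minus_one_pos by simp
  finally show ?thesis .
qed

text \<open>A zero codeword would place the whole variety on the quadric, but there are more than
  \<open>max_count\<close> isotropic vectors.\<close>

lemma codeword_optimal_pair_nonzero:
  assumes f: "f \<in> quadratic_forms" and opt: "optimal_pair f"
  shows "codeword t f \<noteq> (\<lambda>P\<in>herm_variety t. 0)"
proof
  assume zero: "codeword t f = (\<lambda>P\<in>herm_variety t. 0)"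
  have "herm_variety t \<subseteq> zero_set f"
  proof
    fix P assume P: "P \<in> (herm_variety t :: ('a ^ 5) set set)"
    then have "point_value f P = 0" using fun_cong[OF zero, of P] by (simp add: codeword_def)
    then show "P \<in> zero_set f"
      using P point_value_eq_0_iff[OF f, of P] by (simp add: herm_variety_def)
  qed
  have "x \<in> {x. eval_poly f x = 0}" if "H x = 0" for x
  proof (cases "x = 0")
    case False
    have "H y = 0" if "y \<in> vec.span {x}" for y
      using that \<open>H x = 0\<close> by (auto simp: vec.span_singleton H_scale)
    moreover have "vec.span {x} \<in> points" using False by (simp add: points_def vec.subspace_span)
    ultimately have "vec.span {x} \<in> herm_variety t" unfolding herm_variety_def H_def by blast
    then have "vec.span {x} \<in> zero_set f" using \<open>herm_variety t \<subseteq> zero_set f\<close> by blast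
    then show ?thesis using span_in_zero_set_iff[OF f False] by simp
  qed (simp add: eval_poly_0[OF f])
  then have "{x. H x = 0 \<and> eval_poly f x = 0} = {x. H x = 0}" by blast
  from zero_count_optimal_pair[OF assms, unfolded this] card_isotropic_UNIV
  show False by linarith
qed

lemma codeword_nonzero_imp:
  fixes f :: "'a poly5"
  assumes "codeword t f \<noteq> (\<lambda>P\<in>herm_variety t. 0)"
  obtains x where "eval_poly f x \<noteq> 0"
proof -
  have "\<exists>x. eval_poly f x \<noteq> 0"
  proof (rule ccontr)
    assume "\<not> (\<exists>x. eval_poly f x \<noteq> 0)"
    then have "point_value f P = 0" for P by (simp add: point_value_def normalized_eval_def)
    then show False using assms by (simp add: codeword_def)
  qed
  then show ?thesis using that by blast
qed

lemma min_weight_codewords_eq: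
  "(min_weight_codewords t :: (('a ^ 5) set \<Rightarrow> 'a) set)
    = {codeword t f | f. f \<in> quadratic_forms \<and> optimal_pair f}"
proof (intro equalityI subsetI)
  fix w :: "('a ^ 5) set \<Rightarrow> 'a" assume w: "w \<in> min_weight_codewords t"
  note w' = w[unfolded min_weight_codewords_def mem_Collect_eq]
  note nz = w'[THEN conjunct2, THEN conjunct1]
  have min: "weight t w \<le> weight t v" if "v \<in> code2 t" "v \<noteq> (\<lambda>P\<in>herm_variety t. 0)" for v :: "('a ^ 5) set \<Rightarrow> 'a"
    using w'[THEN conjunct2, THEN conjunct2, THEN bspec, OF that(1), THEN mp, OF that(2)] .
  from w'[THEN conjunct1]
  obtain f :: "'a poly5" where f: "f \<in> quadratic_forms" "w = codeword t f"
    unfolding code2_def by blast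
  let ?g = "coordinate_product :: 'a poly5"
  note g = coordinate_product_quadratic optimal_pair_coordinate_product
  have "codeword t ?g \<in> code2 t" unfolding code2_def using g(1) by (rule imageI)
  \<comment> \<open>Comparison with the witness forces at least \<open>max_count\<close> common
    zeros, which only an optimal pair reaches.\<close>
  then have "weight t (codeword t f) \<le> weight t (codeword t ?g)"
    using codeword_optimal_pair_nonzero[OF g] unfolding f(2)[symmetric] by (rule min)
  then have "max_count \<le> zero_count f"
    unfolding weight_le_iff[OF f(1) g(1)] zero_count_optimal_pair[OF g] .
  obtain x where "eval_poly f x \<noteq> 0"
    using nz unfolding f(2) by (rule codeword_nonzero_imp)
  with \<open>max_count \<le> zero_count f\<close> have "optimal_pair f"
    using zero_count_le[OF f(1), of x] by linarith
  with f show "w \<in> {codeword t f | f. f \<in> quadratic_forms \<and> optimal_pair f}" by blast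
next
  fix w :: "('a ^ 5) set \<Rightarrow> 'a"
  assume "w \<in> {codeword t f | f. f \<in> quadratic_forms \<and> optimal_pair f}"
  then obtain f where f: "w = codeword t f" "f \<in> quadratic_forms" "optimal_pair f" by blast
  have "weight t (codeword t f) \<le> weight t (codeword t g)"
    if g: "g \<in> quadratic_forms" "codeword t g \<noteq> (\<lambda>P\<in>herm_variety t. 0)" for g :: "'a poly5"
  proof -
    obtain x where "eval_poly g x \<noteq> 0" using codeword_nonzero_imp[OF g(2)] .
    then have "zero_count g \<le> max_count"
      using zero_count_le[OF g(1)] zero_count_optimal_pair[OF g(1)]
      by (cases "optimal_pair g") (simp_all add: less_imp_le)
    then show ?thesis
      unfolding weight_le_iff[OF f(2) g(1)] zero_count_optimal_pair[OF f(2,3)] .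
  qed
  then have "weight t w \<le> weight t w'"
    if "w' \<in> code2 t" "w' \<noteq> (\<lambda>P\<in>herm_variety t. 0)" for w' :: "('a ^ 5) set \<Rightarrow> 'a"
    using that unfolding code2_def f(1) by blast
  moreover have "w \<in> code2 t" unfolding code2_def f(1) using f(2) by (rule imageI)
  moreover have "w \<noteq> (\<lambda>P\<in>herm_variety t. 0)"
    unfolding f(1) by (rule codeword_optimal_pair_nonzero[OF f(2,3)])
  ultimately show "w \<in> min_weight_codewords t"
    unfolding min_weight_codewords_def by blast
qed

end

theorem theorem6p4:
  fixes t :: nat
  assumes "primepow t"
    and "CARD('a::{field,finite}) = t ^ 2"
  shows "(min_weight_codewords t :: (('a ^ 5) set \<Rightarrow> 'a) set) =
    {codeword t f | f. f \<in> quadratic_forms \<and>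
       (\<exists>U V. hyperplane U \<and> hyperplane V \<and> U \<noteq> V \<and>
          zero_set f = proj U \<union> proj V \<and>
          \<not> tangent_hyperplane t U \<and> \<not> tangent_hyperplane t V \<and>
          nonsingular_plane_section t (U \<inter> V))}"
proof -
  interpret hermitian_field t "TYPE('a)"
    using assms by unfold_locales
  show ?thesis
    using min_weight_codewords_eq unfolding optimal_pair_def .
qed

end
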